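(* Let $m<-2$. There exists a real number $\gamma_*$ (depending on $m$) such that the boundary value problem $$f'''+(m+2)ff''-(2m+1)f'^2=0 \text{ on } [0,\infty),\qquad f(0)=-\gamma,\quad f''(0)=-1,\quad f'(\infty)=0$$ has infinitely many solutions if $\gamma>\gamma_*$, one and only one solution if $\gamma=\gamma_*$, and no solution if $\gamma<\gamma_*$.
   Context: Here $m,\gamma$ are real numbers and $f'(\infty):=\lim_{t\to\infty}f'(t)$. A solution is a three times differentiable function $f:[0,\infty)\to\mathbb{R}$ satisfying the differential equation on $[0,\infty)$ together with all three boundary conditions; $f'(0)$ is not prescribed. *)

theory Defs
  imports "HOL-Analysis.Analysis"
begin

(* Derivatives are taken within {0..}, hence one-sided at 0.  Since no point of {0..} is
   isolated, the values of f1, f2, f3 on {0..} are determined by those of f. *)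
definition bvp_solution :: "real \<Rightarrow> real \<Rightarrow> (real \<Rightarrow> real) \<Rightarrow> bool" where
  "bvp_solution m \<gamma> f \<longleftrightarrow>
     (\<exists>f1 f2 f3 :: real \<Rightarrow> real.
        (\<forall>t\<ge>0. (f has_real_derivative f1 t) (at t within {0..})) \<and>
        (\<forall>t\<ge>0. (f1 has_real_derivative f2 t) (at t within {0..})) \<and>
        (\<forall>t\<ge>0. (f2 has_real_derivative f3 t) (at t within {0..})) \<and>
        (\<forall>t\<ge>0. f3 t + (m + 2) * f t * f2 t - (2 * m + 1) * (f1 t)\<^sup>2 = 0) \<and>
        f 0 = - \<gamma> \<and> f2 0 = - 1 \<and> (f1 \<longlongrightarrow> 0) at_top)"

(* A function on [0,\<infinity>) is represented by the HOL function that agrees with it on {0..}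
   and is undefined elsewhere, so that solutions are counted as functions on [0,\<infinity>). *)
definition bvp_solutions :: "real \<Rightarrow> real \<Rightarrow> (real \<Rightarrow> real) set" where
  "bvp_solutions m \<gamma> = {f \<in> extensional {0..}. bvp_solution m \<gamma> f}"

end

theory Submission
  imports Defs
begin

text \<open>With \<open>a = - (m + 2) > 0\<close>, \<open>x = - f\<close>, \<open>y = x'\<close>, \<open>z = x''\<close> the equation becomes
  \<open>z' = (2 a + 3) y\<^sup>2 - a x z\<close>, and solutions of the boundary value problem are exactly those
  with \<open>x > 0\<close>, \<open>y < 0\<close>, \<open>z > 0\<close> throughout. The scaling \<open>x \<mapsto> k x(k t)\<close> reduces the equation to a
  planar flow for the slope \<open>P = - y / x\<^sup>2\<close> and the curvature \<open>Q = z / x\<^sup>3\<close>; the boundary data fix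
  \<open>Q(0) = 1 / \<gamma>\<^sup>3\<close> and leave \<open>P(0)\<close> free. The region \<open>Q > 2 P\<^sup>2\<close> is forward invariant, \<open>P\<close> decreases
  there, and an orbit of this region below that of a solution belongs to a solution as well. The
  initial data of solutions form a closed set, so the least height \<open>\<gamma>\<^sub>0\<close> is attained. There \<open>Q\<close> is
  maximal among all solutions, hence stationary, which determines \<open>P\<close>. For \<open>\<gamma> > \<gamma>\<^sub>0\<close> the extremal
  orbit descends to the level \<open>1 / \<gamma>\<^sup>3\<close>, and the points of that level below the part of the orbit
  just before its arrival give infinitely many solutions.\<close>

subsection \<open>Differential inequalities and global Lipschitz equations\<close>

lemma mvt_within:
  fixes f :: "real \<Rightarrow> real"
  assumes f: "\<And>t. t \<in> {a..b} \<Longrightarrow> (f has_real_derivative f' t) (at t within {a..b})"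
    and st: "a \<le> s" "s < t" "t \<le> b"
  obtains \<xi> where "s < \<xi>" "\<xi> < t" "f t - f s = f' \<xi> * (t - s)"
proof -
  have "\<exists>\<xi>\<in>{s<..<t}. f t - f s = f' \<xi> * (t - s)"
  proof (rule mvt_simple[OF \<open>s < t\<close>, where f = f and f' = "\<lambda>\<xi>. (*) (f' \<xi>)"])
    fix \<xi> assume "s \<le> \<xi>" "\<xi> \<le> t"
    then have "(f has_derivative (*) (f' \<xi>)) (at \<xi> within {a..b})"
      using f[of \<xi>] st by (simp add: has_field_derivative_def)
    then show "(f has_derivative (*) (f' \<xi>)) (at \<xi> within {s..t})"
      by (rule has_derivative_subset) (use st in auto)
  qed
  then show thesis using that by auto
qed

lemma nondecreasing_within:
  fixes f :: "real \<Rightarrow> real"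
  assumes f: "\<And>t. t \<in> {a..b} \<Longrightarrow> (f has_real_derivative f' t) (at t within {a..b})"
    and f': "\<And>t. t \<in> {a..b} \<Longrightarrow> 0 \<le> f' t" and st: "a \<le> s" "s \<le> t" "t \<le> b"
  shows "f s \<le> f t"
proof (cases "s = t")
  case False
  then have "s < t" using st by simp
  obtain \<xi> where \<xi>: "s < \<xi>" "\<xi> < t" "f t - f s = f' \<xi> * (t - s)"
    by (rule mvt_within[OF f st(1) \<open>s < t\<close> st(3)])
  have "0 \<le> f' \<xi> * (t - s)" using f'[of \<xi>] \<xi> st by simp
  then show ?thesis using \<xi>(3) by simp
qed simp

lemma increasing_within:
  fixes f :: "real \<Rightarrow> real"
  assumes f: "\<And>t. t \<in> {a..b} \<Longrightarrow> (f has_real_derivative f' t) (at t within {a..b})"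
    and f': "\<And>t. t \<in> {a<..<b} \<Longrightarrow> 0 < f' t" and st: "a \<le> s" "s < t" "t \<le> b"
  shows "f s < f t"
proof -
  obtain \<xi> where \<xi>: "s < \<xi>" "\<xi> < t" "f t - f s = f' \<xi> * (t - s)"
    by (rule mvt_within[OF f st])
  have "0 < f' \<xi> * (t - s)" using f'[of \<xi>] \<xi> st by simp
  then show ?thesis using \<xi>(3) by simp
qed

text \<open>Integrating factor: with \<open>K\<close> an antiderivative of \<open>k\<close>, the
  product \<open>u * exp K\<close> is nondecreasing.\<close>

lemma positive_of_linear_inequality:
  fixes u k :: "real \<Rightarrow> real"
  assumes u: "\<And>t. t \<in> {0..T} \<Longrightarrow> (u has_real_derivative u' t) (at t within {0..T})"
    and k: "continuous_on {0..T} k"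
    and ge: "\<And>t. t \<in> {0..T} \<Longrightarrow> 0 \<le> u' t + k t * u t"
    and "0 < u 0" "t \<in> {0..T}"
  shows "0 < u t"
proof -
  define K where "K s = integral {0..s} k" for s
  have K: "(K has_real_derivative k s) (at s within {0..T})" if "s \<in> {0..T}" for s
    unfolding K_def by (rule integral_has_real_derivative[OF k that])
  have "u 0 * exp (K 0) \<le> u t * exp (K t)"
  proof (rule nondecreasing_within[of 0 T "\<lambda>s. u s * exp (K s)"
        "\<lambda>s. u' s * exp (K s) + exp (K s) * k s * u s"])
    fix s assume s: "s \<in> {0..T}"
    show "((\<lambda>s. u s * exp (K s)) has_real_derivative u' s * exp (K s) + exp (K s) * k s * u s)
        (at s within {0..T})"
      by (rule DERIV_mult[OF u[OF s] DERIV_chain2[OF DERIV_exp K[OF s]]])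
    have "u' s * exp (K s) + exp (K s) * k s * u s = exp (K s) * (u' s + k s * u s)"
      by (simp add: algebra_simps)
    then show "0 \<le> u' s * exp (K s) + exp (K s) * k s * u s" using ge[OF s] by simp
  qed (use assms in auto)
  then show ?thesis using \<open>0 < u 0\<close>
    by (smt (verit) exp_gt_zero mult_pos_pos zero_less_mult_pos2)
qed

text \<open>The set where \<open>u \<le> 0\<close> is compact, so it has a least element
  \<open>s\<close>; the intermediate value theorem yields a zero in \<open>{0..s}\<close>, which can
  only be \<open>s\<close> itself.\<close>

lemma first_zero:
  fixes u :: "real \<Rightarrow> real"
  assumes u: "continuous_on {0..T} u" and "0 < u 0" "0 \<le> T" "u T \<le> 0"
  obtains s where "0 < s" "s \<le> T" "u s = 0" "\<And>r. 0 \<le> r \<Longrightarrow> r < s \<Longrightarrow> 0 < u r"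
proof -
  define B where "B = {0..T} \<inter> u -` {..0}"
  have "closed B" unfolding B_def by (rule continuous_closed_preimage[OF u]) auto
  then have "compact B" unfolding B_def
    by (meson bounded_Int bounded_closed_interval compact_eq_bounded_closed)
  moreover have "B \<noteq> {}" unfolding B_def using assms by auto
  ultimately obtain s where s: "s \<in> B" "\<And>r. r \<in> B \<Longrightarrow> s \<le> r"
    using compact_attains_inf[of B] by auto
  have pos: "0 < u r" if "0 \<le> r" "r < s" for r
  proof (rule ccontr)
    assume "\<not> 0 < u r"
    then have "r \<in> B" using that s(1) unfolding B_def by auto
    then show False using s(2) that by force
  qed
  have s0: "0 < s" using s(1) assms unfolding B_def by (cases "s = 0") auto
  have "continuous_on {0..s} u" using s(1) u unfolding B_def by (auto intro: continuous_on_subset)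
  then obtain r where "0 \<le> r" "r \<le> s" "u r = 0"
    using IVT2'[of u s 0 0] s(1) s0 assms unfolding B_def by auto
  then have "u s = 0" using pos[of r] by (cases "r = s") auto
  then show thesis using that[of s] s0 s(1) pos unfolding B_def by auto
qed

section \<open>Gronwall estimate and global existence for Lipschitz fields\<close>

text \<open>The squared distance weighted by \<open>exp (- 2 * L * s)\<close> is nonincreasing,
  because Cauchy-Schwarz and the Lipschitz bound give
  \<open>d \<bullet> d' \<le> L * (d \<bullet> d)\<close>.\<close>

lemma gronwall:
  fixes x y :: "real \<Rightarrow> 'a::real_inner"
  assumes L: "L-lipschitz_on UNIV F"
    and x: "\<And>t. t \<in> {0..T} \<Longrightarrow> (x has_vector_derivative F (x t)) (at t within {0..T})"
    and y: "\<And>t. t \<in> {0..T} \<Longrightarrow> (y has_vector_derivative F (y t)) (at t within {0..T})"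
    and t: "t \<in> {0..T}"
  shows "dist (x t) (y t) \<le> exp (L * t) * dist (x 0) (y 0)"
proof -
  define d where "d s = x s - y s" for s
  define d' where "d' s = F (x s) - F (y s)" for s
  define u where "u s = - (exp (- 2 * L * s) * (d s \<bullet> d s))" for s
  have d: "(d has_vector_derivative d' s) (at s within {0..T})" if "s \<in> {0..T}" for s
    unfolding d_def d'_def using x[OF that] y[OF that] by (rule has_vector_derivative_diff)
  have dd: "((\<lambda>s. d s \<bullet> d s) has_real_derivative 2 * (d s \<bullet> d' s)) (at s within {0..T})"
    if "s \<in> {0..T}" for s
  proof -
    have "((\<lambda>s. d s \<bullet> d s) has_derivative (\<lambda>h. d s \<bullet> (h *\<^sub>R d' s) + (h *\<^sub>R d' s) \<bullet> d s)) (at s within {0..T})"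
      using d[OF that] unfolding has_vector_derivative_def
      by (intro has_derivative_inner) auto
    then show ?thesis unfolding has_field_derivative_def
      by (rule has_derivative_eq_rhs) (auto simp: inner_commute algebra_simps)
  qed
  have "u 0 \<le> u t"
  proof (rule nondecreasing_within[of 0 T u
        "\<lambda>s. 2 * exp (- 2 * L * s) * (L * (d s \<bullet> d s) - d s \<bullet> d' s)"])
    fix s assume s: "s \<in> {0..T}"
    show "(u has_real_derivative 2 * exp (- 2 * L * s) * (L * (d s \<bullet> d s) - d s \<bullet> d' s))
        (at s within {0..T})"
      unfolding u_def
      by (rule derivative_eq_intros dd[OF s] refl | simp)+ (simp add: algebra_simps)
    have "d s \<bullet> d' s \<le> norm (d s) * norm (d' s)" by (rule norm_cauchy_schwarz)
    also have "\<dots> \<le> norm (d s) * (L * norm (d s))"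
      using lipschitz_onD[OF L, of "x s" "y s"] unfolding d_def d'_def
      by (intro mult_left_mono) (auto simp: dist_norm)
    also have "\<dots> = L * (d s \<bullet> d s)" by (simp add: dot_square_norm power2_eq_square)
    finally show "0 \<le> 2 * exp (- 2 * L * s) * (L * (d s \<bullet> d s) - d s \<bullet> d' s)" by simp
  qed (use t in auto)
  then have "exp (- 2 * L * t) * (norm (d t))\<^sup>2 \<le> (norm (d 0))\<^sup>2"
    unfolding u_def by (simp add: dot_square_norm)
  then have "(norm (d t))\<^sup>2 \<le> exp (2 * L * t) * (norm (d 0))\<^sup>2"
    by (simp add: exp_minus field_simps)
  also have "\<dots> = (exp (L * t) * norm (d 0))\<^sup>2"
    by (simp add: power_mult_distrib flip: exp_double)
  finally show ?thesis unfolding d_def dist_norm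
    by (rule power2_le_imp_le) simp
qed

text \<open>The factor \<open>1 / k\<close> gained by integrating the weight is what makes the
  Picard operator contract.\<close>

lemma norm_integral_le_exp:
  fixes f :: "real \<Rightarrow> 'a::banach"
  assumes k: "0 < k" and t: "0 \<le> t" and C: "0 \<le> C"
    and f: "f integrable_on {0..t}" and le: "\<And>s. s \<in> {0..t} \<Longrightarrow> norm (f s) \<le> C * exp (k * s)"
  shows "norm (integral {0..t} f) \<le> C / k * exp (k * t)"
proof -
  have "((\<lambda>s. C * exp (k * s)) has_integral C * exp (k * t) / k - C * exp (k * 0) / k) {0..t}"
  proof (rule fundamental_theorem_of_calculus[OF t])
    fix s
    have "((\<lambda>s. C * exp (k * s) / k) has_real_derivative C * exp (k * s)) (at s within {0..t})"
      using k by (auto intro!: derivative_eq_intros)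
    then show "((\<lambda>s. C * exp (k * s) / k) has_vector_derivative C * exp (k * s)) (at s within {0..t})"
      by (simp add: has_real_derivative_iff_has_vector_derivative)
  qed
  then have "norm (integral {0..t} f) \<le> C * exp (k * t) / k - C * exp (k * 0) / k"
    using integral_norm_bound_integral[OF f _ le] by (metis has_integral_iff)
  moreover have "0 \<le> C / k" using C k by simp
  ultimately show ?thesis by simp
qed

text \<open>Weighting by \<open>exp (- k t)\<close> with \<open>k > L\<close> makes the Picard operator a contraction on the
  whole half-line, so no continuation of local solutions is needed.\<close>

lemma picard_lindeloef_global:
  fixes F :: "'a::banach \<Rightarrow> 'a"
  assumes L: "L-lipschitz_on UNIV F"
  shows "\<exists>x. x 0 = x0 \<and> (\<forall>T. \<forall>t\<in>{0..T}. (x has_vector_derivative F (x t)) (at t within {0..T}))"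
proof -
  \<comment> \<open>This choice gives \<open>L / k \<le> 1 / 2\<close>, the contraction constant
    below.\<close>
  define k where "k = 2 * L + 1"
  have L0: "0 \<le> L" using L by (rule lipschitz_on_nonneg)
  then have k: "0 < k" "L / k \<le> 1 / 2" by (auto simp: k_def field_simps)
  \<comment> \<open>The unknown \<open>u\<close> is the solution divided by
    \<open>exp (k * s)\<close>, which keeps it bounded. In \<open>G\<close>, \<open>max 0 t\<close>
    freezes it at negative times, as bounded continuous functions live on the whole line.\<close>
  define f where "f u s = F (exp (k * s) *\<^sub>R apply_bcontfun u s)" for u :: "real \<Rightarrow>\<^sub>C 'a" and s
  define I where "I u t = integral {0..t} (f u)" for u t
  define G where "G u t = exp (- k * max 0 t) *\<^sub>R (x0 + I u (max 0 t))" for u t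
  have F: "continuous_on UNIV F" using L by (rule lipschitz_on_continuous_on)
  have cont: "continuous_on S (f u)" for u S
    unfolding f_def by (rule continuous_on_compose2[OF F]) (auto intro!: continuous_intros)
  note int = integrable_continuous_real[OF cont]
  have f: "norm (f u s - f v s) \<le> L * dist u v * exp (k * s)" for u v s
  proof -
    have "norm (f u s - f v s) \<le> L * (exp (k * s) * dist (apply_bcontfun u s) (apply_bcontfun v s))"
      using lipschitz_onD[OF L UNIV_I UNIV_I, of "exp (k * s) *\<^sub>R apply_bcontfun u s"
          "exp (k * s) *\<^sub>R apply_bcontfun v s"]
      by (simp add: f_def dist_norm flip: scaleR_diff_right)
    also have "\<dots> \<le> L * (exp (k * s) * dist u v)"
      using L0 by (intro mult_left_mono dist_bounded) auto
    finally show ?thesis by (simp add: mult_ac)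
  qed
  have I: "norm (I u t - I v t) \<le> L * dist u v / k * exp (k * t)" if "0 \<le> t" for u v t
    unfolding I_def integral_diff[OF int int, symmetric]
    by (rule norm_integral_le_exp) (use k L0 that f integrable_diff[OF int int] in auto)
  have I0: "norm (I 0 t) \<le> norm (F 0) / k * exp (k * t)" if "0 \<le> t" for t
    unfolding I_def
  proof (rule norm_integral_le_exp)
    fix s assume "s \<in> {0..t}"
    then have "1 \<le> exp (k * s)" using k by simp
    then show "norm (f 0 s) \<le> norm (F 0) * exp (k * s)"
      by (simp add: f_def mult_le_cancel_left1)
  qed (use k that int in auto)
  have G_bcontfun: "G u \<in> bcontfun" for u
  proof (rule bcontfun_normI)
    have "continuous_on {0..} (I u)"
      unfolding continuous_on_eq_continuous_within
    proof
      fix t :: real assume "t \<in> {0..}"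
      then have t: "t \<in> {0..t + 1}" by simp
      have "continuous_on {0..t + 1} (I u)"
        unfolding I_def by (rule indefinite_integral_continuous_1[OF int])
      then have "continuous (at t within {0..t + 1}) (I u)"
        using t by (simp add: continuous_on_eq_continuous_within)
      moreover have "at t within {0..t + 1} = at t within {0..}"
        by (rule at_within_nhd[of _ "{..<t + 1}"]) auto
      ultimately show "continuous (at t within {0..}) (I u)" by simp
    qed
    then have "continuous_on UNIV (\<lambda>t. I u (max 0 t))"
      by (rule continuous_on_compose2) (auto intro!: continuous_intros)
    then show "continuous_on UNIV (G u)"
      unfolding G_def by (intro continuous_intros)
    fix t :: real
    define \<tau> where "\<tau> = max 0 t"
    have \<tau>: "0 \<le> \<tau>" by (simp add: \<tau>_def)
    have "norm (x0 + I u \<tau>) \<le> norm x0 + norm (I u \<tau> - I 0 \<tau>) + norm (I 0 \<tau>)"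
      by (metis add.assoc add_left_mono diff_add_cancel norm_triangle_ineq norm_triangle_le)
    also have "\<dots> \<le> norm x0 * exp (k * \<tau>) + L * dist u 0 / k * exp (k * \<tau>)
        + norm (F 0) / k * exp (k * \<tau>)"
      using I[OF \<tau>, of u 0] I0[OF \<tau>] k \<tau> by (intro add_mono) (auto simp: mult_le_cancel_left1)
    also have "\<dots> = exp (k * \<tau>) * (norm x0 + L * dist u 0 / k + norm (F 0) / k)"
      by (simp add: algebra_simps)
    finally have "exp (- k * \<tau>) * norm (x0 + I u \<tau>)
        \<le> exp (- k * \<tau>) * (exp (k * \<tau>) * (norm x0 + L * dist u 0 / k + norm (F 0) / k))"
      by (rule mult_left_mono) simp
    then show "norm (G u t) \<le> norm x0 + L * dist u 0 / k + norm (F 0) / k"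
      unfolding G_def \<tau>_def[symmetric] by (simp add: exp_minus mult.assoc[symmetric])
  qed
  define H where "H u = Bcontfun (G u)" for u
  have H: "apply_bcontfun (H u) = G u" for u
    unfolding H_def using G_bcontfun by (rule Bcontfun_inverse)
  have "\<exists>!u. H u = u"
  proof (rule banach_fix_type[of "1 / 2"])
    show "\<forall>u v. dist (H u) (H v) \<le> 1 / 2 * dist u v"
    proof (intro allI dist_bound)
      fix u v and t :: real
      define \<tau> where "\<tau> = max 0 t"
      have \<tau>: "0 \<le> \<tau>" by (simp add: \<tau>_def)
      have "dist (G u t) (G v t) = exp (- k * \<tau>) * norm (I u \<tau> - I v \<tau>)"
        unfolding G_def \<tau>_def[symmetric] dist_norm by (simp flip: scaleR_diff_right)
      also have "\<dots> \<le> exp (- k * \<tau>) * (L * dist u v / k * exp (k * \<tau>))"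
        using I[OF \<tau>] by (intro mult_left_mono) auto
      also have "\<dots> = L / k * dist u v" by (simp add: exp_minus field_simps)
      also have "\<dots> \<le> 1 / 2 * dist u v" using k by (intro mult_right_mono) auto
      finally show "dist (apply_bcontfun (H u) t) (apply_bcontfun (H v) t) \<le> 1 / 2 * dist u v"
        by (simp add: H)
    qed
  qed auto
  then obtain u where u: "G u = apply_bcontfun u" by (metis H)
  define x where "x t = x0 + I u t" for t
  have xt: "exp (k * t) *\<^sub>R apply_bcontfun u t = x t" if "0 \<le> t" for t
    using fun_cong[OF u, of t, symmetric] that by (simp add: G_def x_def exp_minus)
  have "(x has_vector_derivative F (x t)) (at t within {0..T})" if t: "t \<in> {0..T}" for t T
  proof -
    have "(I u has_vector_derivative f u t) (at t within {0..T})"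
      unfolding I_def by (rule integral_has_vector_derivative[OF cont t])
    then have "(x has_vector_derivative f u t) (at t within {0..T})"
      unfolding x_def by (auto intro!: derivative_eq_intros)
    then show ?thesis using xt t by (simp add: f_def)
  qed
  moreover have "x 0 = x0" by (simp add: x_def I_def)
  ultimately show ?thesis by blast
qed

text \<open>Bridges the half-line derivatives of the boundary value problem and the compact
  intervals used from here on: near \<open>t\<close> the sets \<open>{0..t + 1}\<close> and
  \<open>{0..}\<close> coincide.\<close>

lemma has_real_derivative_iff_all_intervals:
  "(\<forall>t\<ge>0. (f has_real_derivative f' t) (at t within {0..})) \<longleftrightarrow>
    (\<forall>T. \<forall>t\<in>{0..T}. (f has_real_derivative f' t) (at t within {0..T}))"
proof
  assume *: "\<forall>T. \<forall>t\<in>{0..T}. (f has_real_derivative f' t) (at t within {0..T})"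
  show "\<forall>t\<ge>0. (f has_real_derivative f' t) (at t within {0..})"
  proof (intro allI impI)
    fix t :: real assume "0 \<le> t"
    then have "(f has_real_derivative f' t) (at t within {0..t + 1})" using * by simp
    moreover have "at t within {0..t + 1} = at t within {0..}"
      by (rule at_within_nhd[of _ "{..<t + 1}"]) auto
    ultimately show "(f has_real_derivative f' t) (at t within {0..})" by simp
  qed
next
  assume *: "\<forall>t\<ge>0. (f has_real_derivative f' t) (at t within {0..})"
  show "\<forall>T. \<forall>t\<in>{0..T}. (f has_real_derivative f' t) (at t within {0..T})"
  proof (intro allI ballI)
    fix t T :: real assume "t \<in> {0..T}"
    then have "(f has_real_derivative f' t) (at t within {0..})" using * by simp
    then show "(f has_real_derivative f' t) (at t within {0..T})"
      by (rule has_field_derivative_subset) auto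
  qed
qed

subsection \<open>The third order equation and its scaling\<close>

definition clamp_at :: "real \<Rightarrow> real \<Rightarrow> real" where
  "clamp_at R u = max (- R) (min R u)"

lemma clamp_at_id: "\<bar>u\<bar> \<le> R \<Longrightarrow> clamp_at R u = u"
  by (auto simp: clamp_at_def)

lemma abs_clamp_at_le: "0 \<le> R \<Longrightarrow> \<bar>clamp_at R u\<bar> \<le> R"
  by (auto simp: clamp_at_def)

lemma abs_clamp_at_diff: "\<bar>clamp_at R u - clamp_at R v\<bar> \<le> \<bar>u - v\<bar>"
  by (auto simp: clamp_at_def)

lemma abs_clamp_at_mult_diff:
  assumes "0 \<le> R"
  shows "\<bar>clamp_at R u * clamp_at R v - clamp_at R u' * clamp_at R v'\<bar> \<le> R * (\<bar>u - u'\<bar> + \<bar>v - v'\<bar>)"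
proof -
  have "clamp_at R u * clamp_at R v - clamp_at R u' * clamp_at R v'
      = clamp_at R u * (clamp_at R v - clamp_at R v') + clamp_at R v' * (clamp_at R u - clamp_at R u')"
    by (simp add: algebra_simps)
  also have "\<bar>\<dots>\<bar> \<le> \<bar>clamp_at R u\<bar> * \<bar>clamp_at R v - clamp_at R v'\<bar>
      + \<bar>clamp_at R v'\<bar> * \<bar>clamp_at R u - clamp_at R u'\<bar>"
    by (metis abs_mult abs_triangle_ineq)
  also have "\<dots> \<le> R * \<bar>v - v'\<bar> + R * \<bar>u - u'\<bar>"
    by (intro add_mono mult_mono abs_clamp_at_le abs_clamp_at_diff assms) auto
  finally show ?thesis by (simp add: algebra_simps)
qed

lemma dist_Pair_le: "dist (u, v) (u', v') \<le> dist u u' + dist v v'"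
  by (simp add: dist_Pair_Pair sqrt_sum_squares_le_sum)

definition slope :: "(real \<Rightarrow> real) \<Rightarrow> (real \<Rightarrow> real) \<Rightarrow> real \<Rightarrow> real" where
  "slope x y t = - y t / (x t) ^ 2"

definition curv :: "(real \<Rightarrow> real) \<Rightarrow> (real \<Rightarrow> real) \<Rightarrow> real \<Rightarrow> real" where
  "curv x z t = z t / (x t) ^ 3"

locale flow =
  fixes a b :: real
  assumes a_pos: "0 < a" and b_eq: "b = 2 * a + 3"
begin

text \<open>Posed on \<open>{0..T}\<close>, because orbits that do not decay are followed only up to
  the time when \<open>y\<close> vanishes.\<close>

definition sol :: "real \<Rightarrow> (real \<Rightarrow> real) \<Rightarrow> (real \<Rightarrow> real) \<Rightarrow> (real \<Rightarrow> real) \<Rightarrow> bool" where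
  "sol T x y z \<longleftrightarrow> (\<forall>t\<in>{0..T}.
     (x has_real_derivative y t) (at t within {0..T}) \<and>
     (y has_real_derivative z t) (at t within {0..T}) \<and>
     (z has_real_derivative b * (y t)\<^sup>2 - a * x t * z t) (at t within {0..T}))"

text \<open>Vanishing of \<open>y\<close> at infinity is not demanded: it follows by
  \<open>decaying_y_tendsto_0\<close>, and together with \<open>0 < z 0\<close> it conversely
  implies the signs by \<open>decaying_of_limit\<close>.\<close>

definition decaying :: "(real \<Rightarrow> real) \<Rightarrow> (real \<Rightarrow> real) \<Rightarrow> (real \<Rightarrow> real) \<Rightarrow> bool" where
  "decaying x y z \<longleftrightarrow> (\<forall>T. sol T x y z) \<and> (\<forall>t\<ge>0. 0 < x t \<and> y t < 0 \<and> 0 < z t)"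

definition decaying_data :: "real \<Rightarrow> real \<Rightarrow> real \<Rightarrow> bool" where
  "decaying_data x0 y0 z0 \<longleftrightarrow> (\<exists>x y z. decaying x y z \<and> x 0 = x0 \<and> y 0 = y0 \<and> z 0 = z0)"

text \<open>The first-order system for \<open>(x, y, z)\<close>, truncated in its quadratic part so
  as to be globally Lipschitz; solutions bounded by \<open>R\<close> do not see the
  truncation.\<close>

definition field :: "real \<Rightarrow> real \<times> real \<times> real \<Rightarrow> real \<times> real \<times> real" where
  "field R v = (fst (snd v), snd (snd v),
     b * (clamp_at R (fst (snd v)))\<^sup>2 - a * (clamp_at R (fst v) * clamp_at R (snd (snd v))))"

lemma solD:
  assumes "sol T x y z" "t \<in> {0..T}"
  shows "(x has_real_derivative y t) (at t within {0..T})"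
    "(y has_real_derivative z t) (at t within {0..T})"
    "(z has_real_derivative b * (y t)\<^sup>2 - a * x t * z t) (at t within {0..T})"
  using assms unfolding sol_def by auto

lemma sol_continuous:
  assumes "sol T x y z"
  shows "continuous_on {0..T} x" "continuous_on {0..T} y" "continuous_on {0..T} z"
  by (rule DERIV_continuous_on[OF solD(1)[OF assms]] DERIV_continuous_on[OF solD(2)[OF assms]]
      DERIV_continuous_on[OF solD(3)[OF assms]], assumption)+

text \<open>The equation is autonomous, and under the scaling with weights 1, 2, 3 for
  \<open>x\<close>, \<open>y\<close>, \<open>z\<close> both terms of \<open>z'\<close> acquire the
  factor \<open>k ^ 4\<close>.\<close>

lemma sol_rescale:
  assumes sol: "sol (s + k * T) x y z" and s: "0 \<le> s" and k: "0 < k"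
  shows "sol T (\<lambda>t. k * x (s + k * t)) (\<lambda>t. k ^ 2 * y (s + k * t)) (\<lambda>t. k ^ 3 * z (s + k * t))"
proof -
  have chain: "((\<lambda>t. c * u (s + k * t)) has_real_derivative c * k * u' (s + k * t)) (at t within {0..T})"
    if t: "t \<in> {0..T}"
      and u: "\<And>r. r \<in> {0..s + k * T} \<Longrightarrow> (u has_real_derivative u' r) (at r within {0..s + k * T})"
    for c t u u'
  proof -
    have sub: "(\<lambda>t. s + k * t) ` {0..T} \<subseteq> {0..s + k * T}" using s k by auto
    have "(u has_real_derivative u' (s + k * t)) (at (s + k * t) within (\<lambda>t. s + k * t) ` {0..T})"
      by (rule has_field_derivative_subset[OF u sub]) (use sub t in blast)
    moreover have "((\<lambda>t. s + k * t) has_real_derivative k) (at t within {0..T})"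
      by (auto intro!: derivative_eq_intros)
    ultimately have "((\<lambda>t. u (s + k * t)) has_real_derivative u' (s + k * t) * k) (at t within {0..T})"
      using DERIV_image_chain[of u "u' (s + k * t)" "\<lambda>t. s + k * t" t "{0..T}" k]
      by (simp add: o_def)
    then show ?thesis
      by (auto intro!: derivative_eq_intros)
  qed
  show ?thesis
    unfolding sol_def
  proof
    fix t assume t: "t \<in> {0..T}"
    show "((\<lambda>t. k * x (s + k * t)) has_real_derivative k ^ 2 * y (s + k * t)) (at t within {0..T}) \<and>
      ((\<lambda>t. k ^ 2 * y (s + k * t)) has_real_derivative k ^ 3 * z (s + k * t)) (at t within {0..T}) \<and>
      ((\<lambda>t. k ^ 3 * z (s + k * t)) has_real_derivative
        b * (k ^ 2 * y (s + k * t))\<^sup>2 - a * (k * x (s + k * t)) * (k ^ 3 * z (s + k * t)))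
        (at t within {0..T})"
      using chain[OF t solD(1)[OF sol], of k] chain[OF t solD(2)[OF sol], of "k ^ 2"]
        chain[OF t solD(3)[OF sol], of "k ^ 3"]
      by (simp add: algebra_simps power2_eq_square power3_eq_cube)
  qed
qed

lemma decaying_rescale:
  assumes "decaying x y z" "0 \<le> s" "0 < k"
  shows "decaying (\<lambda>t. k * x (s + k * t)) (\<lambda>t. k ^ 2 * y (s + k * t)) (\<lambda>t. k ^ 3 * z (s + k * t))"
  using assms sol_rescale[of s k _ x y z] unfolding decaying_def
  by (auto simp: mult_pos_neg)

lemma decaying_data_rescale:
  assumes "decaying x y z" "0 \<le> s" "0 < k"
  shows "decaying_data (k * x s) (k ^ 2 * y s) (k ^ 3 * z s)"
  using decaying_rescale[OF assms] unfolding decaying_data_def by fastforce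

lemma lipschitz_field:
  assumes R: "0 \<le> R"
  shows "(2 + 2 * b * R + 2 * a * R)-lipschitz_on UNIV (field R)"
proof (rule lipschitz_onI)
  fix v w :: "real \<times> real \<times> real"
  obtain x y z x' y' z' where v: "v = (x, y, z)" and w: "w = (x', y', z')" by (metis prod_cases3)
  define d where "d = dist v w"
  have le: "\<bar>x - x'\<bar> \<le> d" "\<bar>y - y'\<bar> \<le> d" "\<bar>z - z'\<bar> \<le> d"
  proof -
    have "dist x x' \<le> d" "dist (y, z) (y', z') \<le> d"
      using dist_fst_le[of v w] dist_snd_le[of v w] by (auto simp: v w d_def)
    moreover have "dist y y' \<le> dist (y, z) (y', z')" "dist z z' \<le> dist (y, z) (y', z')"
      using dist_fst_le[of "(y, z)" "(y', z')"] dist_snd_le[of "(y, z)" "(y', z')"] by auto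
    ultimately show "\<bar>x - x'\<bar> \<le> d" "\<bar>y - y'\<bar> \<le> d" "\<bar>z - z'\<bar> \<le> d"
      by (auto simp: dist_real_def)
  qed
  let ?p = "b * (clamp_at R y)\<^sup>2 - a * (clamp_at R x * clamp_at R z)"
  let ?q = "b * (clamp_at R y')\<^sup>2 - a * (clamp_at R x' * clamp_at R z')"
  have "?p - ?q = b * (clamp_at R y * clamp_at R y - clamp_at R y' * clamp_at R y')
      - a * (clamp_at R x * clamp_at R z - clamp_at R x' * clamp_at R z')"
    by (simp add: algebra_simps power2_eq_square)
  also have "\<bar>\<dots>\<bar> \<le> \<bar>b * (clamp_at R y * clamp_at R y - clamp_at R y' * clamp_at R y')\<bar>
      + \<bar>a * (clamp_at R x * clamp_at R z - clamp_at R x' * clamp_at R z')\<bar>"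
    by (rule abs_triangle_ineq4)
  also have "\<dots> \<le> b * (R * (\<bar>y - y'\<bar> + \<bar>y - y'\<bar>)) + a * (R * (\<bar>x - x'\<bar> + \<bar>z - z'\<bar>))"
    using abs_clamp_at_mult_diff[OF R, of y y y' y'] abs_clamp_at_mult_diff[OF R, of x z x' z']
      a_pos b_eq by (simp add: abs_mult add_mono)
  also have "\<dots> \<le> b * (R * (d + d)) + a * (R * (d + d))"
    using a_pos b_eq R le by (intro add_mono mult_left_mono) auto
  finally have last: "\<bar>?p - ?q\<bar> \<le> (2 * b * R + 2 * a * R) * d" by (simp add: algebra_simps)
  have "dist (field R v) (field R w) \<le> \<bar>y - y'\<bar> + dist (z, ?p) (z', ?q)"
    using dist_Pair_le[of y "(z, ?p)" y' "(z', ?q)"] by (simp add: v w field_def dist_real_def)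
  also have "dist (z, ?p) (z', ?q) \<le> \<bar>z - z'\<bar> + \<bar>?p - ?q\<bar>"
    using dist_Pair_le[of z ?p z' ?q] by (simp add: dist_real_def)
  finally show "dist (field R v) (field R w) \<le> (2 + 2 * b * R + 2 * a * R) * dist v w"
    using last le unfolding d_def[symmetric] by (simp add: algebra_simps)
qed (use a_pos b_eq R in auto)

lemma vector_derivative_of_sol:
  assumes sol: "sol T x y z" and t: "t \<in> {0..T}"
    and R: "\<bar>x t\<bar> \<le> R" "\<bar>y t\<bar> \<le> R" "\<bar>z t\<bar> \<le> R"
  shows "((\<lambda>t. (x t, y t, z t)) has_vector_derivative field R (x t, y t, z t)) (at t within {0..T})"
  using solD[OF sol t] R
  by (auto simp: field_def clamp_at_id has_real_derivative_iff_has_vector_derivative mult.assoc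
      intro!: has_vector_derivative_Pair)

lemma sol_of_vector_derivative:
  assumes v: "\<And>t. t \<in> {0..T} \<Longrightarrow> (v has_vector_derivative field R (v t)) (at t within {0..T})"
    and R: "\<And>t. t \<in> {0..T} \<Longrightarrow> \<bar>fst (v t)\<bar> \<le> R \<and> \<bar>fst (snd (v t))\<bar> \<le> R \<and> \<bar>snd (snd (v t))\<bar> \<le> R"
  shows "sol T (\<lambda>t. fst (v t)) (\<lambda>t. fst (snd (v t))) (\<lambda>t. snd (snd (v t)))"
  unfolding sol_def
proof
  fix t assume t: "t \<in> {0..T}"
  note fst = bounded_linear.has_vector_derivative[OF bounded_linear_fst]
  note snd = bounded_linear.has_vector_derivative[OF bounded_linear_snd]
  show "((\<lambda>t. fst (v t)) has_real_derivative fst (snd (v t))) (at t within {0..T}) \<and>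
    ((\<lambda>t. fst (snd (v t))) has_real_derivative snd (snd (v t))) (at t within {0..T}) \<and>
    ((\<lambda>t. snd (snd (v t))) has_real_derivative
      b * (fst (snd (v t)))\<^sup>2 - a * fst (v t) * snd (snd (v t))) (at t within {0..T})"
    using fst[OF v[OF t]] fst[OF snd[OF v[OF t]]] snd[OF snd[OF v[OF t]]] R[OF t]
    by (simp add: field_def clamp_at_id has_real_derivative_iff_has_vector_derivative mult.assoc)
qed

text \<open>On a compact interval both solutions stay in a common box, where the truncated field is
  the true one, so \<open>gronwall\<close> applies with initial distance \<open>0\<close>.\<close>

lemma sol_unique:
  assumes 1: "sol T x y z" and 2: "sol T x' y' z'"
    and init: "x 0 = x' 0" "y 0 = y' 0" "z 0 = z' 0" and t: "t \<in> {0..T}"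
  shows "x t = x' t" "y t = y' t" "z t = z' t"
proof -
  define N where "N t = \<bar>x t\<bar> + \<bar>y t\<bar> + \<bar>z t\<bar> + \<bar>x' t\<bar> + \<bar>y' t\<bar> + \<bar>z' t\<bar>" for t
  have "continuous_on {0..T} N"
    unfolding N_def by (intro continuous_intros sol_continuous[OF 1] sol_continuous[OF 2])
  then have "bounded (N ` {0..T})" by (intro compact_imp_bounded compact_continuous_image) auto
  then obtain R where "\<forall>t\<in>{0..T}. N t \<le> R" by (auto simp: bounded_real) (meson abs_le_D1)
  then have R: "\<bar>x t\<bar> \<le> R \<and> \<bar>y t\<bar> \<le> R \<and> \<bar>z t\<bar> \<le> R \<and> \<bar>x' t\<bar> \<le> R \<and> \<bar>y' t\<bar> \<le> R \<and> \<bar>z' t\<bar> \<le> R"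
    if "t \<in> {0..T}" for t
    using that unfolding N_def by force
  have "0 \<le> R" using R[OF t] by linarith
  have "dist (x t, y t, z t) (x' t, y' t, z' t) \<le>
      exp ((2 + 2 * b * R + 2 * a * R) * t) * dist (x 0, y 0, z 0) (x' 0, y' 0, z' 0)"
    by (rule gronwall[OF lipschitz_field[OF \<open>0 \<le> R\<close>], where T = T and x = "\<lambda>t. (x t, y t, z t)"
          and y = "\<lambda>t. (x' t, y' t, z' t)"])
      (use vector_derivative_of_sol[OF 1] vector_derivative_of_sol[OF 2] R t in auto)
  then show "x t = x' t" "y t = y' t" "z t = z' t" using init by auto
qed

subsection \<open>Decaying solutions\<close>

text \<open>\<open>z' + a x z = b y^2\<close> is nonnegative whatever the signs of \<open>x\<close>
  and \<open>y\<close>.\<close>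

lemma sol_z_pos:
  assumes sol: "sol T x y z" and "0 < z 0" "t \<in> {0..T}"
  shows "0 < z t"
proof (rule positive_of_linear_inequality[OF solD(3)[OF sol], of "\<lambda>t. a * x t"])
  show "continuous_on {0..T} (\<lambda>t. a * x t)"
    by (intro continuous_intros sol_continuous[OF sol])
  show "0 \<le> b * (y t)\<^sup>2 - a * x t * z t + a * x t * z t" for t
    using a_pos b_eq by simp
qed (use assms in auto)

text \<open>Where \<open>x > 0\<close>, the condition says that \<open>1 / x\<close> is strictly
  concave. With \<open>u = x z - 2 y^2\<close> and \<open>b = 2 * a + 3\<close> one finds
  \<open>u' + a x u = 3 x y^2 - 3 y z\<close>, which the signs make nonnegative.\<close>

lemma sol_convexity_pos:
  assumes sol: "sol T x y z" and sign: "\<And>t. t \<in> {0..T} \<Longrightarrow> 0 \<le> x t \<and> y t \<le> 0 \<and> 0 \<le> z t"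
    and init: "2 * (y 0)\<^sup>2 < x 0 * z 0" and t: "t \<in> {0..T}"
  shows "2 * (y t)\<^sup>2 < x t * z t"
proof -
  have "0 < x t * z t - 2 * (y t)\<^sup>2"
  proof (rule positive_of_linear_inequality[where u = "\<lambda>t. x t * z t - 2 * (y t)\<^sup>2"
        and k = "\<lambda>t. a * x t" and T = T
        and u' = "\<lambda>t. x t * (b * (y t)\<^sup>2 - a * x t * z t) - 3 * y t * z t"])
    fix s assume s: "s \<in> {0..T}"
    show "((\<lambda>t. x t * z t - 2 * (y t)\<^sup>2) has_real_derivative
        x s * (b * (y s)\<^sup>2 - a * x s * z s) - 3 * y s * z s) (at s within {0..T})"
      by (rule derivative_eq_intros solD[OF sol s] refl | simp add: algebra_simps)+
    have "x s * (b * (y s)\<^sup>2 - a * x s * z s) - 3 * y s * z s + a * x s * (x s * z s - 2 * (y s)\<^sup>2)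
        = 3 * x s * (y s)\<^sup>2 + 3 * (- y s) * z s"
      by (simp add: b_eq algebra_simps power2_eq_square)
    also have "\<dots> \<ge> 0" using sign[OF s] by (intro add_nonneg_nonneg mult_nonneg_nonneg) auto
    finally show "0 \<le> x s * (b * (y s)\<^sup>2 - a * x s * z s) - 3 * y s * z s
        + a * x s * (x s * z s - 2 * (y s)\<^sup>2)" .
  next
    show "continuous_on {0..T} (\<lambda>t. a * x t)"
      by (intro continuous_intros sol_continuous[OF sol])
  qed (use init t in auto)
  then show ?thesis by simp
qed

lemma decayingD:
  assumes "decaying x y z"
  shows "sol T x y z" "0 \<le> t \<Longrightarrow> 0 < x t" "0 \<le> t \<Longrightarrow> y t < 0" "0 \<le> t \<Longrightarrow> 0 < z t"
  using assms unfolding decaying_def by auto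

lemma decaying_y_mono:
  assumes dec: "decaying x y z" and st: "0 \<le> s" "s < t"
  shows "y s < y t"
  by (rule increasing_within[OF solD(2)[OF decayingD(1)[OF dec, of t]]])
    (use st decayingD(4)[OF dec] in auto)

lemma sol_x_antimono:
  assumes sol: "sol T x y z" and y: "\<And>r. r \<in> {0..T} \<Longrightarrow> y r \<le> 0" and "0 \<le> s" "s \<le> t" "t \<le> T"
  shows "x t \<le> x s"
proof -
  have "- x s \<le> - x t"
    by (rule nondecreasing_within[where f' = "\<lambda>t. - y t" and a = 0 and b = T and f = "\<lambda>t. - x t"])
      (use assms DERIV_minus[OF solD(1)[OF sol]] in auto)
  then show ?thesis by simp
qed

lemma sol_y_mono:
  assumes sol: "sol T x y z" and z: "\<And>r. r \<in> {0..T} \<Longrightarrow> 0 \<le> z r" and "0 \<le> s" "s \<le> t" "t \<le> T"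
  shows "y s \<le> y t"
  by (rule nondecreasing_within[OF solD(2)[OF sol] z]) (use assms in auto)

text \<open>As \<open>y\<close> increases, \<open>y \<le> - e\<close> at all late times would mean
  \<open>y \<le> - e\<close> always, and \<open>x\<close> would reach \<open>0\<close> by the time
  \<open>x 0 / e\<close>.\<close>

lemma decaying_y_near_0:
  assumes dec: "decaying x y z" and e: "0 < e"
  obtains t where "s \<le> t" "0 \<le> t" "- e < y t"
proof (rule ccontr)
  assume "\<not> thesis"
  then have no: "\<not> (s \<le> t \<and> 0 \<le> t \<and> - e < y t)" for t using that by blast
  have *: "y t \<le> - e" if "0 \<le> t" for t
  proof (rule ccontr)
    assume "\<not> y t \<le> - e"
    then have "- e < y (max s t)"
      using decaying_y_mono[OF dec that, of s] by (cases "t < s") (auto simp: max_def)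
    then show False using that no[of "max s t"] by (auto simp: max_def split: if_splits)
  qed
  define T where "T = x 0 / e"
  have "0 \<le> T" using decayingD(2)[OF dec, of 0] e by (simp add: T_def)
  have "- e * 0 - x 0 \<le> - e * T - x T"
  proof (rule nondecreasing_within[where a = 0 and b = T and f' = "\<lambda>t. - e - y t"
      and f = "\<lambda>t. - e * t - x t"])
    fix t assume t: "t \<in> {0..T}"
    show "((\<lambda>t. - e * t - x t) has_real_derivative - e - y t) (at t within {0..T})"
      by (rule derivative_eq_intros solD[OF decayingD(1)[OF dec] t] refl | simp)+
  qed (use * \<open>0 \<le> T\<close> in \<open>auto simp: field_simps\<close>)
  then have "x T \<le> 0" using e by (simp add: T_def)
  then show False using decayingD(2)[OF dec \<open>0 \<le> T\<close>] by simp
qed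

lemma decaying_y_tendsto_0:
  assumes dec: "decaying x y z"
  shows "(y \<longlongrightarrow> 0) at_top"
proof (rule order_tendstoI)
  fix c :: real assume "c < 0"
  then obtain s where s: "0 \<le> s" "c < y s"
    using decaying_y_near_0[OF dec, of "- c" 0] by auto
  have "c < y t" if "s \<le> t" for t
    using s that decaying_y_mono[OF dec s(1), of t] by (cases "s = t") auto
  then show "eventually (\<lambda>t. c < y t) at_top" unfolding eventually_at_top_linorder by blast
next
  fix c :: real assume "0 < c"
  then have "y t < c" if "0 \<le> t" for t using decayingD(3)[OF dec that] by simp
  then show "eventually (\<lambda>t. y t < c) at_top" unfolding eventually_at_top_linorder by blast
qed

text \<open>The total flux \<open>z + a x y\<close> is increasing and, as \<open>y\<close> stays bounded, it cannot become
  positive.\<close>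

lemma decaying_flux_neg:
  assumes dec: "decaying x y z" and t0: "0 \<le> t0"
  shows "z t0 + a * x t0 * y t0 < 0"
proof (rule ccontr)
  assume h0: "\<not> z t0 + a * x t0 * y t0 < 0"
  define h where "h t = z t + a * x t * y t" for t
  have h: "(h has_real_derivative (a + b) * (y t)\<^sup>2) (at t within {0..T})" if "t \<in> {0..T}" for t T
    unfolding h_def
    by (rule derivative_eq_intros solD[OF decayingD(1)[OF dec] that] refl | simp)+
      (simp add: algebra_simps power2_eq_square)
  have h_mono: "h s < h t" if "0 \<le> s" "s < t" for s t
    by (rule increasing_within[where a = 0 and b = t and f = h, OF h]) (use that a_pos b_eq decayingD(3)[OF dec] in \<open>auto simp: less_le\<close>)
  \<comment> \<open>Strict growth makes the flux positive one time unit later even if it vanishes at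
    \<open>t0\<close>; from then on \<open>z \<ge> e\<close>.\<close>
  define e where "e = h (t0 + 1)"
  have e: "0 < e" using h_mono[of t0 "t0 + 1"] h0 t0 unfolding e_def h_def by simp
  have z: "e \<le> z t" if t: "t0 + 1 \<le> t" for t
  proof -
    have "e \<le> h t" using h_mono[of "t0 + 1" t] t t0 unfolding e_def by (cases "t = t0 + 1") auto
    moreover have "a * x t * y t \<le> 0"
      using decayingD[OF dec, of t] t t0 a_pos by (simp add: mult_nonneg_nonpos)
    ultimately show ?thesis by (simp add: h_def)
  qed
  \<comment> \<open>By this time \<open>y\<close>, growing at rate at least \<open>e\<close>, has
    reached \<open>0\<close>.\<close>
  define T where "T = t0 + 1 - y (t0 + 1) / e"
  have T: "t0 + 1 \<le> T" using decayingD(3)[OF dec, of "t0 + 1"] t0 e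
    by (simp add: T_def divide_nonpos_pos)
  have "y (t0 + 1) - e * (t0 + 1) \<le> y T - e * T"
  proof (rule nondecreasing_within[where a = "t0 + 1" and b = T and f' = "\<lambda>t. z t - e"
      and f = "\<lambda>t. y t - e * t"])
    fix t assume t: "t \<in> {t0 + 1..T}"
    then have "t \<in> {0..T}" using t0 by simp
    then have "((\<lambda>t. y t - e * t) has_real_derivative z t - e) (at t within {0..T})"
      by (auto intro!: derivative_eq_intros solD[OF decayingD(1)[OF dec]])
    then show "((\<lambda>t. y t - e * t) has_real_derivative z t - e) (at t within {t0 + 1..T})"
      by (rule has_field_derivative_subset) (use t0 in auto)
    show "0 \<le> z t - e" using z t by simp
  qed (use T in auto)
  moreover have "e * T = e * (t0 + 1) - y (t0 + 1)" using e by (simp add: T_def right_diff_distrib)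
  ultimately have "0 \<le> y T" by linarith
  then show False using decayingD(3)[OF dec, of T] T t0 by simp
qed

text \<open>The negated flux is the derivative of \<open>g = - y - a / 2 * x^2\<close>. Once
  positive, \<open>g\<close> would keep \<open>- y\<close> away from \<open>0\<close>, against
  \<open>decaying_y_near_0\<close>. The bound later provides compactness.\<close>

lemma decaying_slope_bound:
  assumes dec: "decaying x y z" and t0: "0 \<le> t0"
  shows "- y t0 \<le> a / 2 * (x t0)\<^sup>2"
proof (rule ccontr)
  assume "\<not> - y t0 \<le> a / 2 * (x t0)\<^sup>2"
  define g where "g t = - y t - a / 2 * (x t)\<^sup>2" for t
  have g: "g t0 \<le> g t" if "t0 \<le> t" for t
  proof (rule nondecreasing_within[where a = 0 and b = t and f = g
      and f' = "\<lambda>t. - (z t + a * x t * y t)"])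
    fix s assume s: "s \<in> {0..t}"
    show "(g has_real_derivative - (z s + a * x s * y s)) (at s within {0..t})"
      unfolding g_def
      by (rule derivative_eq_intros solD[OF decayingD(1)[OF dec] s] refl | simp)+
    show "0 \<le> - (z s + a * x s * y s)" using decaying_flux_neg[OF dec, of s] s by simp
  qed (use t0 that in auto)
  have "0 < g t0" using \<open>\<not> _\<close> by (simp add: g_def)
  then obtain t where t: "t0 \<le> t" "- g t0 < y t"
    using decaying_y_near_0[OF dec, of "g t0" t0] by auto
  have "0 \<le> a / 2 * (x t)\<^sup>2" using a_pos by simp
  then have "g t0 \<le> - y t" using g[OF t(1)] unfolding g_def by linarith
  then show False using t by simp
qed

section \<open>The alternative between decay and a zero of the derivative\<close>

text \<open>The truncated flow exists for all time, and until \<open>y\<close> first vanishes it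
  stays strictly inside the box, where it solves the true equation. Either \<open>y\<close> never
  vanishes and the solution is decaying, or \<open>T\<close> is its first zero.\<close>

lemma ivp_alternative:
  assumes init: "0 < x0" "y0 < 0" "0 < z0" "2 * y0\<^sup>2 < x0 * z0"
  shows "decaying_data x0 y0 z0 \<or>
    (\<exists>T x y z. 0 < T \<and> sol T x y z \<and> x 0 = x0 \<and> y 0 = y0 \<and> z 0 = z0 \<and> y T = 0 \<and>
      (\<forall>t\<in>{0..T}. 0 < x t \<and> 0 < z t \<and> 2 * (y t)\<^sup>2 < x t * z t) \<and> (\<forall>t\<in>{0..<T}. y t < 0))"
proof -
  \<comment> \<open>Exceeds the a priori bounds \<open>x0\<close>, \<open>- y0\<close> and
    \<open>z0 + (a + b) * (- y0) * x0\<close> for \<open>x\<close>, \<open>- y\<close> and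
    \<open>z\<close> while \<open>y \<le> 0\<close>; the last one comes from \<open>W\<close>
    below.\<close>
  define R where "R = x0 - y0 + z0 + (a + b) * (- y0) * x0 + 1"
  have nn: "0 \<le> (a + b) * (- y0) * x0" using init a_pos b_eq by (simp add: mult_nonneg_nonpos mult_nonpos_nonneg)
  then have R: "0 \<le> R" "x0 < R" "- y0 < R" "z0 + (a + b) * (- y0) * x0 < R"
    using init unfolding R_def by linarith+
  obtain v where v0: "v 0 = (x0, y0, z0)"
    and v: "\<And>T t. t \<in> {0..T} \<Longrightarrow> (v has_vector_derivative field R (v t)) (at t within {0..T})"
    using picard_lindeloef_global[OF lipschitz_field[OF R(1)], of "(x0, y0, z0)"] by blast
  define x y z where "x t = fst (v t)" and "y t = fst (snd (v t))" and "z t = snd (snd (v t))" for t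
  have init': "x 0 = x0" "y 0 = y0" "z 0 = z0" by (simp_all add: x_def y_def z_def v0)
  have cont_v: "continuous_on {0..T} v" for T
    unfolding continuous_on_eq_continuous_within
    by (meson v has_vector_derivative_continuous)
  have cont: "continuous_on {0..T} x" "continuous_on {0..T} y" "continuous_on {0..T} z" for T
    unfolding x_def y_def z_def by (intro continuous_intros cont_v)+
  have sol_of_box: "sol T x y z"
    if "\<And>t. t \<in> {0..T} \<Longrightarrow> \<bar>x t\<bar> \<le> R \<and> \<bar>y t\<bar> \<le> R \<and> \<bar>z t\<bar> \<le> R" for T
    using sol_of_vector_derivative[of T v R] v that unfolding x_def y_def z_def by blast
  \<comment> \<open>\<open>U > 0\<close> collects \<open>0 < x\<close>, \<open>0 < z\<close>,
    \<open>x < R\<close>, \<open>- y < R\<close> and \<open>z < R\<close>; it is shown to have no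
    first zero while \<open>y \<le> 0\<close>.\<close>
  define U where "U t = min (min (x t) (z t)) (min (R - x t) (min (R + y t) (R - z t)))" for t
  have U0: "0 < U 0" using init nn R unfolding U_def init' by (auto simp: R_def)
  have U_pos: "0 < U t" if y: "\<And>t. t \<in> {0..T} \<Longrightarrow> y t \<le> 0" and t: "t \<in> {0..T}" for T t
  proof (rule ccontr)
    assume "\<not> 0 < U t"
    moreover have "continuous_on {0..t} U"
      unfolding U_def by (intro continuous_intros cont)
    ultimately obtain s where s: "0 < s" "s \<le> t" "U s = 0" "\<And>r. 0 \<le> r \<Longrightarrow> r < s \<Longrightarrow> 0 < U r"
      using first_zero[of t U] U0 t by auto
    have U: "0 \<le> U r" if "r \<in> {0..s}" for r using s(3) s(4)[of r] that by (cases "r = s") auto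
    have box: "0 \<le> x r" "0 \<le> z r" "x r \<le> R" "- R \<le> y r" "z r \<le> R" "y r \<le> 0" if "r \<in> {0..s}" for r
      using U[OF that] y[of r] that s t unfolding U_def by auto
    have sol: "sol s x y z" by (rule sol_of_box) (use box R(1) in fastforce)
    have sS: "s \<in> {0..s}" "0 \<in> {0..s}" using s by auto
    \<comment> \<open>Convexity forbids that \<open>x\<close> or \<open>z\<close> vanishes at the
      exit time \<open>s\<close>.\<close>
    have D: "2 * (y s)\<^sup>2 < x s * z s"
      by (rule sol_convexity_pos[OF sol]) (use box init init' sS in auto)
    have "0 \<le> 2 * (y s)\<^sup>2" by simp
    then have "0 < x s * z s" using D by linarith
    then have xz: "0 < x s" "0 < z s" using box[OF sS(1)] by (auto simp: zero_less_mult_iff)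
    have xs: "x s \<le> x0" using sol_x_antimono[OF sol, of 0 s] box s init' by auto
    have ys: "y0 \<le> y r" if "r \<in> {0..s}" for r
      using sol_y_mono[OF sol, of 0 r] box s init' that by auto
    \<comment> \<open>The flux alone increases; the term in \<open>x\<close> compensates for this as
      long as \<open>y0 \<le> y \<le> 0\<close>, which bounds \<open>z\<close>.\<close>
    define W where "W t = - (z t + a * x t * y t + (a + b) * (- y0) * x t)" for t
    have "W 0 \<le> W s"
    proof (rule nondecreasing_within[where a = 0 and b = s and f = W
          and f' = "\<lambda>t. (a + b) * ((- y t) * (y t - y0))"])
      fix r assume r: "r \<in> {0..s}"
      show "(W has_real_derivative (a + b) * ((- y r) * (y r - y0))) (at r within {0..s})"
        unfolding W_def
        by (rule derivative_eq_intros solD[OF sol r] refl | simp)+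
          (simp add: algebra_simps power2_eq_square)
      have "0 \<le> (- y r) * (y r - y0)" using ys[OF r] box[OF r] by (intro mult_nonneg_nonneg) auto
      then show "0 \<le> (a + b) * ((- y r) * (y r - y0))" using a_pos b_eq by (intro mult_nonneg_nonneg[of "a + b"]) linarith+
    qed (use s in auto)
    moreover have "a * (x s * (- y s)) \<le> a * (x0 * (- y0))"
      using xs ys[OF sS(1)] box[OF sS(1)] init a_pos by (intro mult_left_mono mult_mono) auto
    moreover have "0 \<le> (a + b) * (- y0) * x s"
      using init xz a_pos b_eq by (intro mult_nonneg_nonneg) auto
    ultimately have "z s \<le> z0 + (a + b) * (- y0) * x0"
      unfolding W_def init' by (simp add: algebra_simps)
    then have "0 < U s"
      using xz xs ys[OF sS(1)] R unfolding U_def by auto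
    then show False using s by simp
  qed
  have sol: "sol T x y z" and pos: "\<And>t. t \<in> {0..T} \<Longrightarrow> 0 < x t \<and> 0 < z t"
    if "\<And>t. t \<in> {0..T} \<Longrightarrow> y t \<le> 0" for T
  proof -
    have U: "0 < U t" if "t \<in> {0..T}" for t by (rule U_pos[OF _ that]) fact
    show "sol T x y z"
    proof (rule sol_of_box)
      fix t assume "t \<in> {0..T}"
      then show "\<bar>x t\<bar> \<le> R \<and> \<bar>y t\<bar> \<le> R \<and> \<bar>z t\<bar> \<le> R"
        using U[of t] that[of t] R(1) unfolding U_def by auto
    qed
    show "0 < x t \<and> 0 < z t" if "t \<in> {0..T}" for t
      using U[OF that] unfolding U_def by auto
  qed
  show ?thesis
  proof (cases "\<exists>t\<ge>0. 0 \<le> y t")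
    case True
    then obtain t where t: "0 \<le> t" "0 \<le> y t" by blast
    have "continuous_on {0..t} (\<lambda>t. - y t)" by (intro continuous_intros cont)
    then obtain T where T: "0 < T" "- y T = 0" "\<And>r. 0 \<le> r \<Longrightarrow> r < T \<Longrightarrow> 0 < - y r"
      by (rule first_zero) (use t init init' in auto)
    have y: "y r \<le> 0" if "r \<in> {0..T}" for r
      using T(2) T(3)[of r] that by (cases "r = T") auto
    have S: "sol T x y z" by (rule sol[OF y])
    have P: "0 < x r \<and> 0 < z r" if "r \<in> {0..T}" for r by (rule pos[OF y that])
    have "2 * (y r)\<^sup>2 < x r * z r" if "r \<in> {0..T}" for r
    proof (rule sol_convexity_pos[OF S _ _ that])
      show "0 \<le> x t \<and> y t \<le> 0 \<and> 0 \<le> z t" if "t \<in> {0..T}" for t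
        using P[OF that] y[OF that] by simp
    qed (use init init' in simp)
    then have "\<forall>t\<in>{0..T}. 0 < x t \<and> 0 < z t \<and> 2 * (y t)\<^sup>2 < x t * z t" using P by blast
    moreover have "y T = 0" "\<forall>t\<in>{0..<T}. y t < 0" using T by simp_all
    ultimately show ?thesis using T(1) S init' by blast
  next
    case False
    then have y: "y t < 0" if "0 \<le> t" for t using that by (meson not_le)
    then have y': "y t \<le> 0" if "t \<in> {0..T}" for t T using that by (simp add: less_imp_le)
    have "sol T x y z" for T by (rule sol[OF y'])
    moreover have "0 < x t \<and> 0 < z t" if "0 \<le> t" for t
      by (rule pos[of t, OF y']) (use that in auto)
    ultimately have "decaying x y z" using y unfolding decaying_def by blast
    then show ?thesis using init' unfolding decaying_data_def by blast
  qed
qed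

subsection \<open>The planar flow of slope and curvature\<close>

text \<open>Together with \<open>curv_deriv\<close> this is the planar flow: apart from the positive
  factor \<open>x\<close>, a change of time, the right-hand sides depend on slope and curvature
  alone. The slope itself is the derivative of \<open>1 / x\<close>.\<close>

lemma slope_deriv:
  assumes sol: "sol T x y z" and t: "t \<in> {0..T}" and x: "0 < x t"
  shows "(slope x y has_real_derivative - (x t * (curv x z t - 2 * (slope x y t)\<^sup>2))) (at t within {0..T})"
proof -
  have "(slope x y has_real_derivative
      - ((z t * (x t)\<^sup>2 - y t * (2 * x t * y t)) / ((x t)\<^sup>2 * (x t)\<^sup>2))) (at t within {0..T})"
    unfolding slope_def using x
    by (auto intro!: derivative_eq_intros solD[OF sol t] simp: mult_ac)
  moreover have "- ((z t * (x t)\<^sup>2 - y t * (2 * x t * y t)) / ((x t)\<^sup>2 * (x t)\<^sup>2))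
      = - (x t * (curv x z t - 2 * (slope x y t)\<^sup>2))"
    using x by (simp add: slope_def curv_def field_simps power2_eq_square power3_eq_cube)
  ultimately show ?thesis by simp
qed

lemma curv_deriv:
  assumes sol: "sol T x y z" and t: "t \<in> {0..T}" and x: "0 < x t"
  shows "(curv x z has_real_derivative
    x t * (b * (slope x y t)\<^sup>2 - a * curv x z t + 3 * slope x y t * curv x z t)) (at t within {0..T})"
proof -
  have "(curv x z has_real_derivative
      ((b * (y t)\<^sup>2 - a * x t * z t) * x t ^ 3 - z t * (3 * (x t)\<^sup>2 * y t)) / (x t ^ 3 * x t ^ 3))
      (at t within {0..T})"
    unfolding curv_def using x
    by (auto intro!: derivative_eq_intros solD[OF sol t] simp: eval_nat_numeral)
  moreover have "((b * (y t)\<^sup>2 - a * x t * z t) * x t ^ 3 - z t * (3 * (x t)\<^sup>2 * y t)) / (x t ^ 3 * x t ^ 3)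
      = x t * (b * (slope x y t)\<^sup>2 - a * curv x z t + 3 * slope x y t * curv x z t)"
    using x by (simp add: slope_def curv_def field_simps power2_eq_square power3_eq_cube)
  ultimately show ?thesis by simp
qed

lemma slope_curv_continuous:
  assumes sol: "sol T x y z" and x: "\<And>t. t \<in> {0..T} \<Longrightarrow> 0 < x t"
  shows "continuous_on {0..T} (slope x y)" "continuous_on {0..T} (curv x z)"
  by (rule DERIV_continuous_on[OF slope_deriv[OF sol _ x]], assumption+)
    (rule DERIV_continuous_on[OF curv_deriv[OF sol _ x]], assumption+)

lemma convexity_iff:
  assumes "0 < x t"
  shows "2 * (y t)\<^sup>2 < x t * z t \<longleftrightarrow> 2 * (slope x y t)\<^sup>2 < curv x z t"
  using assms by (simp add: slope_def curv_def field_simps power2_eq_square power3_eq_cube)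

lemma slope_antimono:
  assumes sol: "sol T x y z" and x: "\<And>t. t \<in> {0..T} \<Longrightarrow> 0 < x t"
    and E: "\<And>t. t \<in> {0..T} \<Longrightarrow> 2 * (y t)\<^sup>2 < x t * z t" and st: "0 \<le> s" "s < t" "t \<le> T"
  shows "slope x y t < slope x y s"
proof -
  have "- slope x y s < - slope x y t"
  proof (rule increasing_within[where a = 0 and b = T and f = "\<lambda>t. - slope x y t"])
    fix r assume r: "r \<in> {0..T}"
    show "((\<lambda>t. - slope x y t) has_real_derivative x r * (curv x z r - 2 * (slope x y r)\<^sup>2))
        (at r within {0..T})"
      using DERIV_minus[OF slope_deriv[OF sol r x[OF r]]] by simp
  next
    fix r assume "r \<in> {0<..<T}"
    then have r: "r \<in> {0..T}" by simp
    then show "0 < x r * (curv x z r - 2 * (slope x y r)\<^sup>2)"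
      using x[OF r] E[OF r] convexity_iff[of x r y z] by simp
  qed (use st in auto)
  then show ?thesis by simp
qed

lemma decaying_convexity:
  assumes dec: "decaying x y z" and "2 * (y 0)\<^sup>2 < x 0 * z 0" and "0 \<le> t"
  shows "2 * (y t)\<^sup>2 < x t * z t"
  by (rule sol_convexity_pos[OF decayingD(1)[OF dec, of t]])
    (use assms decayingD[OF dec] in \<open>auto simp: less_imp_le\<close>)

text \<open>The flux inequality divided by \<open>x ^ 3\<close>: decaying orbits lie below the line
  \<open>Q = a P\<close>.\<close>

lemma decaying_curv_less:
  assumes dec: "decaying x y z" and t: "0 \<le> t"
  shows "curv x z t < a * slope x y t"
  using decaying_flux_neg[OF dec t] decayingD(2)[OF dec t]
  by (simp add: slope_def curv_def field_simps power2_eq_square power3_eq_cube)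

text \<open>If the slope stayed above \<open>l > 0\<close>, the bounded quantity \<open>Q - 2 P\<^sup>2 - a P\<close>, where \<open>P\<close> and \<open>Q\<close> are
  slope and curvature, would increase at least as fast as \<open>- 3 l ln x\<close>; hence \<open>x\<close>
  would be bounded away from \<open>0\<close>, and so would \<open>y = - P x\<^sup>2\<close>.\<close>

lemma decaying_slope_small:
  assumes dec: "decaying x y z" and E: "2 * (y 0)\<^sup>2 < x 0 * z 0" and l: "0 < l"
  obtains t where "0 \<le> t" "slope x y t < l"
proof (rule ccontr)
  assume "\<not> thesis"
  then have "\<not> (0 \<le> t \<and> slope x y t < l)" for t using that by blast
  then have P: "l \<le> slope x y t" if "0 \<le> t" for t using that by (meson not_le)
  note sol = decayingD(1)[OF dec] and x = decayingD(2)[OF dec]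
  define M where "M t = curv x z t - 2 * (slope x y t)\<^sup>2 - a * slope x y t + 3 * l * ln (x t)" for t
  have M: "M 0 \<le> M t" if t: "0 \<le> t" for t
  proof (rule nondecreasing_within[where a = 0 and b = t and f = M
        and f' = "\<lambda>t. x t * (3 * slope x y t * (slope x y t - l) + 6 * slope x y t ^ 3
          + 7 * slope x y t * (curv x z t - 2 * (slope x y t)\<^sup>2))"])
    fix s assume s: "s \<in> {0..t}"
    then have xs: "0 < x s" using x by simp
    have ys: "y s = - slope x y s * (x s)\<^sup>2" using xs by (simp add: slope_def)
    have lnx: "((\<lambda>t. ln (x t)) has_real_derivative - slope x y s * x s) (at s within {0..t})"
      using xs by (auto intro!: derivative_eq_intros solD[OF sol s] simp: slope_def power2_eq_square)
    show "(M has_real_derivative x s * (3 * slope x y s * (slope x y s - l) + 6 * slope x y s ^ 3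
          + 7 * slope x y s * (curv x z s - 2 * (slope x y s)\<^sup>2))) (at s within {0..t})"
      unfolding M_def
      by (rule derivative_eq_intros lnx slope_deriv[OF sol s xs] curv_deriv[OF sol s xs] refl)+
        (simp add: b_eq algebra_simps power2_eq_square power3_eq_cube)
    have "2 * (slope x y s)\<^sup>2 < curv x z s"
      using decaying_convexity[OF dec E, of s] s convexity_iff[of x s y z] xs by simp
    then show "0 \<le> x s * (3 * slope x y s * (slope x y s - l) + 6 * slope x y s ^ 3
          + 7 * slope x y s * (curv x z s - 2 * (slope x y s)\<^sup>2))"
      using xs P[of s] l s by (intro mult_nonneg_nonneg add_nonneg_nonneg) auto
  qed (use t in auto)
  define c where "c = exp (M 0 / (3 * l))"
  have c: "c \<le> x t" if t: "0 \<le> t" for t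
  proof -
    \<comment> \<open>By \<open>decaying_curv_less\<close>, all terms of \<open>M\<close> except the
      logarithm add up to a nonpositive quantity.\<close>
    have "0 \<le> 2 * (slope x y t)\<^sup>2" by simp
    then have "M t \<le> 3 * l * ln (x t)"
      using decaying_curv_less[OF dec t] unfolding M_def by linarith
    then have "M 0 / (3 * l) \<le> ln (x t)"
      using M[OF t] l by (simp add: field_simps)
    then show ?thesis using x[OF t] unfolding c_def by (simp add: ln_ge_iff)
  qed
  have "0 < c" by (simp add: c_def)
  then obtain t where t: "0 \<le> t" "- (l * c\<^sup>2) < y t"
    using decaying_y_near_0[OF dec, of "l * c\<^sup>2" 0] l by auto
  have "l * c\<^sup>2 \<le> slope x y t * (x t)\<^sup>2"
    using P[OF t(1)] c[OF t(1)] l \<open>0 < c\<close> by (intro mult_mono power_mono) auto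
  also have "\<dots> = - y t" using x[OF t(1)] by (simp add: slope_def)
  finally show False using t by simp
qed

section \<open>Comparison of orbits in the plane\<close>

text \<open>If the lower orbit in the \<open>(slope, curv)\<close> plane were not decaying, it would have to meet the
  upper one, and from there on the two would agree up to scaling.\<close>

lemma decaying_data_comparison:
  assumes dec: "decaying x y z" and E: "2 * (y 0)\<^sup>2 < x 0 * Z0" and le: "Z0 \<le> z 0"
  shows "decaying_data (x 0) (y 0) Z0"
proof (rule ccontr)
  assume not: "\<not> decaying_data (x 0) (y 0) Z0"
  note sol = decayingD(1)[OF dec] and x = decayingD(2)[OF dec] and y = decayingD(3)[OF dec]
  have "0 \<le> 2 * (y 0)\<^sup>2" by simp
  then have "0 < x 0 * Z0" using E by linarith
  then have "0 < Z0" using x[of 0] by (simp add: zero_less_mult_iff)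
  then obtain T X Y Z where T: "0 < T" and Sol: "sol T X Y Z"
    and init: "X 0 = x 0" "Y 0 = y 0" "Z 0 = Z0" and YT: "Y T = 0"
    and X: "\<And>t. t \<in> {0..T} \<Longrightarrow> 0 < X t" and Z: "\<And>t. t \<in> {0..T} \<Longrightarrow> 0 < Z t"
    and Conv: "\<And>t. t \<in> {0..T} \<Longrightarrow> 2 * (Y t)\<^sup>2 < X t * Z t"
    and Y: "\<And>t. t \<in> {0..<T} \<Longrightarrow> Y t < 0"
    using ivp_alternative[of "x 0" "y 0" Z0] E x[of 0] y[of 0] not by blast
  have E0: "2 * (y 0)\<^sup>2 < x 0 * z 0"
    using mult_left_mono[OF le, of "x 0"] x[of 0] by (intro less_le_trans[OF E]) auto
  note cont1 = slope_curv_continuous[OF sol x] and cont2 = slope_curv_continuous[OF Sol X]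
  have dec1: "slope x y t < slope x y s" if "0 \<le> s" "s < t" for s t
    by (rule slope_antimono[OF sol[of t]]) (use x decaying_convexity[OF dec E0] that in auto)
  have dec2: "slope X Y t < slope X Y s" if "0 \<le> s" "s < t" "t \<le> T" for s t
    by (rule slope_antimono[OF Sol X Conv]) (use that in auto)
  \<comment> \<open>As \<open>Y\<close> vanishes at \<open>T\<close> while \<open>Z\<close> does
    not, the lower orbit ends above the line \<open>Q = a P\<close>, which decaying orbits never
    reach; \<open>t1\<close> is a time shortly before.\<close>
  obtain t1 where t1: "0 \<le> t1" "t1 < T" "a * slope X Y t1 < curv X Z t1"
  proof -
    define w where "w t = curv X Z t - a * slope X Y t" for t
    have "0 < w T" using X[of T] Z[of T] T by (simp add: w_def slope_def curv_def YT)
    moreover have "continuous_on {0..T} w" unfolding w_def by (intro continuous_intros cont2)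
    ultimately obtain d where d: "0 < d" "\<And>t. t \<in> {0..T} \<Longrightarrow> dist t T < d \<Longrightarrow> dist (w t) (w T) < w T"
      using T unfolding continuous_on_iff by fastforce
    define t1 where "t1 = max 0 (T - d / 2)"
    have "0 \<le> t1" "t1 < T" "dist t1 T < d" using T d(1) by (auto simp: t1_def dist_real_def)
    then show thesis using d(2)[of t1] that[of t1] by (auto simp: w_def dist_real_def)
  qed
  have "0 < slope X Y t1" using Y[of t1] X[of t1] t1 by (simp add: slope_def divide_neg_pos)
  \<comment> \<open>The slope of the upper orbit drops below the last slope considered, so on
    \<open>{0..S}\<close> it takes every slope that the lower orbit has on
    \<open>{0..t1}\<close>.\<close>
  then obtain S where S: "0 \<le> S" "slope x y S < slope X Y t1"
    by (rule decaying_slope_small[OF dec E0])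
  have S_cont: "continuous_on {0..S} (slope x y)" by (rule cont1) auto
  have inj: "inj_on (slope x y) {0..S}"
    by (rule linorder_inj_onI') (use dec1 in force)
  \<comment> \<open>Time at which the upper orbit has the slope of the lower one at time
    \<open>t\<close>.\<close>
  define \<sigma> where "\<sigma> t = inv_into {0..S} (slope x y) (slope X Y t)" for t
  have range: "slope X Y t \<in> slope x y ` {0..S}" if "t \<in> {0..t1}" for t
  proof -
    have "slope X Y t1 \<le> slope X Y t" using dec2[of t t1] that t1 by (cases "t = t1") auto
    moreover have "slope X Y t \<le> slope X Y 0" using dec2[of 0 t] that t1 by (cases "t = 0") auto
    moreover have "slope X Y 0 = slope x y 0" by (simp add: slope_def init)
    ultimately obtain r where "0 \<le> r" "r \<le> S" "slope x y r = slope X Y t"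
      using IVT2'[of "slope x y" S "slope X Y t" 0] S S_cont by auto
    then show ?thesis by (metis atLeastAtMost_iff image_eqI)
  qed
  have \<sigma>: "\<sigma> t \<in> {0..S}" "slope x y (\<sigma> t) = slope X Y t" if "t \<in> {0..t1}" for t
    unfolding \<sigma>_def using inv_into_into[OF range[OF that]] f_inv_into_f[OF range[OF that]] by auto
  have \<sigma>_cont: "continuous_on {0..t1} \<sigma>"
  proof -
    have "continuous_on (slope x y ` {0..S}) (inv_into {0..S} (slope x y))"
      by (rule continuous_on_inv[OF S_cont]) (use inj in auto)
    moreover have "continuous_on {0..t1} (slope X Y)"
      by (rule continuous_on_subset[OF cont2(1)]) (use t1 in auto)
    ultimately show ?thesis unfolding \<sigma>_def
      by (rule continuous_on_compose2) (use range in auto)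
  qed
  \<comment> \<open>Vertical gap between the orbits over the same slope: nonnegative at the start,
    nonpositive at \<open>t1\<close>.\<close>
  define \<Delta> where "\<Delta> t = curv x z (\<sigma> t) - curv X Z t" for t
  have "continuous_on {0..t1} \<Delta>"
    unfolding \<Delta>_def
  proof (rule continuous_on_diff)
    have "continuous_on {0..S} (curv x z)" by (rule cont1) auto
    then show "continuous_on {0..t1} (\<lambda>t. curv x z (\<sigma> t))"
      by (rule continuous_on_compose2[OF _ \<sigma>_cont]) (use \<sigma> in auto)
    show "continuous_on {0..t1} (curv X Z)"
      by (rule continuous_on_subset[OF cont2(2)]) (use t1 in auto)
  qed
  moreover have "0 \<le> \<Delta> 0"
  proof -
    have "\<sigma> 0 = 0"
      unfolding \<sigma>_def using inv_into_f_f[OF inj, of 0] S by (simp add: slope_def init)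
    then show ?thesis using le x[of 0] by (simp add: \<Delta>_def curv_def init divide_right_mono)
  qed
  moreover have "\<Delta> t1 \<le> 0"
    using decaying_curv_less[OF dec, of "\<sigma> t1"] \<sigma>[of t1] t1 by (simp add: \<Delta>_def)
  ultimately obtain t0 where t0: "0 \<le> t0" "t0 \<le> t1" "\<Delta> t0 = 0"
    using IVT2'[of \<Delta> t1 0 0] t1 by auto
  define s where "s = \<sigma> t0"
  have s: "0 \<le> s" "slope x y s = slope X Y t0" "curv x z s = curv X Z t0"
    using \<sigma>[of t0] t0 by (auto simp: s_def \<Delta>_def)
  have Xt0: "0 < X t0" and xs: "0 < x s" using X[of t0] x[of s] t0 t1 s by auto
  \<comment> \<open>Equal slope and curvature leave only the scale free, and \<open>k\<close> fixes
    it by matching the heights.\<close>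
  define k where "k = X t0 / x s"
  have k: "0 < k" using Xt0 xs by (simp add: k_def)
  have match: "k * x s = X t0" "k ^ 2 * y s = Y t0" "k ^ 3 * z s = Z t0"
  proof -
    show "k * x s = X t0" using xs by (simp add: k_def)
    have "y s = - slope x y s * (x s)\<^sup>2" "Y t0 = - slope X Y t0 * (X t0)\<^sup>2"
      "z s = curv x z s * (x s) ^ 3" "Z t0 = curv X Z t0 * (X t0) ^ 3"
      using Xt0 xs by (simp_all add: slope_def curv_def)
    then show "k ^ 2 * y s = Y t0" "k ^ 3 * z s = Z t0"
      using s xs by (simp_all add: k_def power_divide)
  qed
  \<comment> \<open>The rescaled upper solution and the lower one now start from the same data, but
    only the latter has vanishing \<open>y\<close> at the end.\<close>
  have "sol (T - t0) (\<lambda>t. k * x (s + k * t)) (\<lambda>t. k ^ 2 * y (s + k * t)) (\<lambda>t. k ^ 3 * z (s + k * t))"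
    by (rule sol_rescale[OF sol s(1) k])
  moreover have "sol (T - t0) (\<lambda>t. X (t0 + t)) (\<lambda>t. Y (t0 + t)) (\<lambda>t. Z (t0 + t))"
    using sol_rescale[of t0 1 "T - t0" X Y Z] Sol t0 by simp
  ultimately have "k ^ 2 * y (s + k * (T - t0)) = Y (t0 + (T - t0))"
    by (rule sol_unique(2)) (use match t0 t1 in auto)
  moreover have "y (s + k * (T - t0)) < 0"
    using y[of "s + k * (T - t0)"] s k t0 t1 by simp
  ultimately show False using k YT by simp
qed

section \<open>Existence of a decaying solution\<close>

text \<open>\<open>z\<close> scales by \<open>k ^ 3\<close>, so a cube root brings it to the
  boundary value.\<close>

lemma decaying_data_normalise:
  assumes dec: "decaying x y z" and t: "0 \<le> t"
  obtains k where "0 < k" "k ^ 3 * z t = 1" "decaying_data (k * x t) (k ^ 2 * y t) 1"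
proof -
  define k where "k = root 3 (1 / z t)"
  have z: "0 < z t" using decayingD(4)[OF dec t] .
  then have k: "0 < k" "k ^ 3 * z t = 1" by (auto simp: k_def)
  show thesis using that[OF k] decaying_data_rescale[OF dec t k(1)] k(2) by simp
qed

text \<open>With \<open>c = a / 2\<close>, the quantity \<open>u = - (z + c x y)\<close> satisfies
  \<open>u' + c x u \<ge> 0\<close> as long as the slope is at most \<open>p\<close>. The slope
  decreases from \<open>p\<close>, so \<open>u\<close> stays positive; this rules out
  \<open>y = 0\<close>, where \<open>u = - z\<close>.\<close>

lemma decaying_data_ex: "\<exists>x0 y0. decaying_data x0 y0 1"
proof -
  define c where "c = a / 2"
  \<comment> \<open>\<open>(b + c) * p = c^2\<close> is the threshold of that inequality.
    \<open>z0\<close> lies midway between \<open>2 * p^2\<close>, needed for convexity, and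
    \<open>c * p\<close>, needed for \<open>u > 0\<close> at the start.\<close>
  define p where "p = c\<^sup>2 / (b + c)"
  define z0 where "z0 = (2 * p\<^sup>2 + c * p) / 2"
  have c: "0 < c" "a = 2 * c" "0 < b + c" using a_pos b_eq by (auto simp: c_def)
  have bp: "(b + c) * p = c\<^sup>2" using c by (simp add: p_def)
  have p: "0 < p" using c by (simp add: p_def)
  have "(2 * c) * (2 * p) < (b + c) * (2 * p)" using p c b_eq by (intro mult_strict_right_mono) auto
  also have "\<dots> = (2 * c) * c" using bp by (simp add: power2_eq_square)
  finally have "2 * p < c" using c by (simp add: mult_less_cancel_left)
  then have pc: "2 * p\<^sup>2 < c * p" using p by (simp add: power2_eq_square)
  have z0: "0 < z0" "2 * p\<^sup>2 < z0" "z0 < c * p" using pc p c by (auto simp: z0_def intro!: add_nonneg_pos)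
  have "decaying_data 1 (- p) z0"
  proof (rule ccontr)
    assume not: "\<not> ?thesis"
    obtain T x y z where T: "0 < T" and sol: "sol T x y z"
      and init: "x 0 = 1" "y 0 = - p" "z 0 = z0" and yT: "y T = 0"
      and x: "\<And>t. t \<in> {0..T} \<Longrightarrow> 0 < x t" and z: "\<And>t. t \<in> {0..T} \<Longrightarrow> 0 < z t"
      and conv: "\<And>t. t \<in> {0..T} \<Longrightarrow> 2 * (y t)\<^sup>2 < x t * z t"
      and y: "\<And>t. t \<in> {0..<T} \<Longrightarrow> y t < 0"
      using ivp_alternative[of 1 "- p" z0] p z0 not by auto
    have "0 < - (z T + c * x T * y T)"
    proof (rule positive_of_linear_inequality[where T = T and k = "\<lambda>t. c * x t"
          and u = "\<lambda>t. - (z t + c * x t * y t)"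
          and u' = "\<lambda>t. c * x t * z t - (b + c) * (y t)\<^sup>2"])
      fix t assume t: "t \<in> {0..T}"
      show "((\<lambda>t. - (z t + c * x t * y t)) has_real_derivative c * x t * z t - (b + c) * (y t)\<^sup>2)
          (at t within {0..T})"
        by (rule derivative_eq_intros solD[OF sol t] refl | simp)+
          (simp add: c algebra_simps power2_eq_square)
      have "slope x y t \<le> slope x y 0"
        using slope_antimono[OF sol x conv, of 0 t] t by (cases "t = 0") auto
      then have "- y t \<le> p * (x t)\<^sup>2" using x[OF t] by (simp add: slope_def init field_simps)
      then have "(b + c) * (- y t) \<le> (b + c) * (p * (x t)\<^sup>2)" using c by (intro mult_left_mono) auto
      also have "\<dots> = c\<^sup>2 * (x t)\<^sup>2" by (simp add: bp flip: mult.assoc)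
      finally have "0 \<le> c\<^sup>2 * (x t)\<^sup>2 - (b + c) * (- y t)" by simp
      moreover have "0 \<le> - y t" using y[of t] yT t by (cases "t = T") auto
      ultimately have "0 \<le> (- y t) * (c\<^sup>2 * (x t)\<^sup>2 - (b + c) * (- y t))"
        by (intro mult_nonneg_nonneg)
      then show "0 \<le> c * x t * z t - (b + c) * (y t)\<^sup>2 + c * x t * - (z t + c * x t * y t)"
        by (simp add: algebra_simps power2_eq_square)
    next
      show "continuous_on {0..T} (\<lambda>t. c * x t)" by (intro continuous_intros sol_continuous[OF sol])
    qed (use T z0 init in auto)
    then show False using z[of T] T yT by simp
  qed
  then obtain x y z where "decaying x y z" unfolding decaying_data_def by blast
  then show ?thesis using decaying_data_normalise[of x y z 0] by (meson order_refl)
qed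

subsection \<open>Limits and backward extension of decaying solutions\<close>

lemma truncated_flow:
  assumes "0 \<le> R"
  obtains v where "v 0 = v0"
    "\<And>T t. t \<in> {0..T} \<Longrightarrow> (v has_vector_derivative field R (v t)) (at t within {0..T})"
  using picard_lindeloef_global[OF lipschitz_field[OF assms], of v0] by blast

lemma sol_eq_truncated_flow:
  assumes sol: "sol T x y z" and box: "\<And>t. t \<in> {0..T} \<Longrightarrow> \<bar>x t\<bar> \<le> R \<and> \<bar>y t\<bar> \<le> R \<and> \<bar>z t\<bar> \<le> R"
    and v: "\<And>t. t \<in> {0..T} \<Longrightarrow> (v has_vector_derivative field R (v t)) (at t within {0..T})"
    and t: "t \<in> {0..T}"
  shows "dist (x t, y t, z t) (v t)
    \<le> exp ((2 + 2 * b * R + 2 * a * R) * t) * dist (x 0, y 0, z 0) (v 0)"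
proof -
  have "0 \<le> R" using box[OF t] by linarith
  show ?thesis
    by (rule gronwall[OF lipschitz_field[OF \<open>0 \<le> R\<close>], where x = "\<lambda>t. (x t, y t, z t)"])
      (use vector_derivative_of_sol[OF sol] box v t in auto)
qed

text \<open>Bounds by the initial data alone, so that a bounded sequence of data yields solutions in
  a common box; the one for \<open>z\<close> is the flux inequality.\<close>

lemma decaying_box:
  assumes dec: "decaying x y z" and t: "0 \<le> t"
  shows "x t \<le> x 0" "y 0 \<le> y t" "z t \<le> a * x 0 * - y 0"
proof -
  note D = decayingD[OF dec]
  show x: "x t \<le> x 0"
    by (rule sol_x_antimono[OF D(1)[of t]]) (use D t in \<open>auto simp: less_imp_le\<close>)
  show y: "y 0 \<le> y t" using decaying_y_mono[OF dec, of 0 t] t by (cases "t = 0") auto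
  have "z t \<le> a * (x t * - y t)" using decaying_flux_neg[OF dec t] by simp
  also have "\<dots> \<le> a * (x 0 * - y 0)"
    using x y D(2)[OF t] D(3)[OF t] D(2)[of 0] a_pos by (intro mult_left_mono mult_mono) auto
  finally show "z t \<le> a * x 0 * - y 0" by simp
qed

text \<open>Limits preserve only weak signs. Positivity of \<open>z\<close> comes from its initial
  value and makes \<open>y\<close> strictly increasing, hence negative; this makes \<open>x\<close>
  strictly decreasing, hence positive.\<close>

lemma decaying_of_weak_signs:
  assumes sol: "\<And>T. sol T x y z" and "0 < z 0"
    and x: "\<And>t. 0 \<le> t \<Longrightarrow> 0 \<le> x t" and y: "\<And>t. 0 \<le> t \<Longrightarrow> y t \<le> 0"
  shows "decaying x y z"
proof -
  have z: "0 < z t" if "0 \<le> t" for t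
    by (rule sol_z_pos[OF sol[of t]]) (use assms that in auto)
  have y': "y t < 0" if "0 \<le> t" for t
  proof -
    have "y t < y (t + 1)"
      by (rule increasing_within[OF solD(2)[OF sol[of "t + 1"]]]) (use z that in auto)
    then show ?thesis using y[of "t + 1"] that by simp
  qed
  have "0 < x t" if "0 \<le> t" for t
  proof -
    have "- x t < - x (t + 1)"
    proof (rule increasing_within[where a = 0 and b = "t + 1" and f = "\<lambda>t. - x t"])
      fix s assume s: "s \<in> {0..t + 1}"
      show "((\<lambda>t. - x t) has_real_derivative - y s) (at s within {0..t + 1})"
        by (rule DERIV_minus[OF solD(1)[OF sol s]])
    qed (use y' that in auto)
    then show ?thesis using x[of "t + 1"] that by simp
  qed
  then show ?thesis using sol y' z unfolding decaying_def by blast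
qed

text \<open>The solutions lie in a common box, so by Gronwall they converge pointwise to the
  truncated flow started at the limit datum. Weak signs and the box pass to the limit, and
  \<open>z 0 = 1\<close> prevents degeneration.\<close>

lemma decaying_data_closed:
  assumes dec: "\<And>n. decaying_data (X n) (Y n) 1" and X: "X \<longlonglongrightarrow> x0" and Y: "Y \<longlonglongrightarrow> y0"
  shows "decaying_data x0 y0 1"
proof -
  obtain x y z where xyz: "\<And>n. decaying (x n) (y n) (z n)"
    and init: "\<And>n. x n 0 = X n" "\<And>n. y n 0 = Y n" "\<And>n. z n 0 = 1"
    using dec unfolding decaying_data_def by metis
  obtain B1 B2 where B: "\<And>n. \<bar>X n\<bar> \<le> B1" "\<And>n. \<bar>Y n\<bar> \<le> B2"
    using convergent_imp_Bseq[OF convergentI[OF X]] convergent_imp_Bseq[OF convergentI[OF Y]]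
    unfolding Bseq_def by auto
  define R where "R = B1 + B2 + a * (B1 * B2)"
  have B0: "0 \<le> B1" "0 \<le> B2" using B[of 0] by linarith+
  have box: "0 \<le> x n t \<and> x n t \<le> R \<and> - R \<le> y n t \<and> y n t \<le> 0 \<and> 0 \<le> z n t \<and> z n t \<le> R"
    if t: "0 \<le> t" for n t
  proof -
    note D = decayingD[OF xyz[of n]] decaying_box[OF xyz[of n] t]
    have "a * (X n * - Y n) \<le> a * (B1 * B2)"
      using B[of n] D(3)[of 0] D(2)[of 0] a_pos B0
      by (intro mult_left_mono mult_mono) (auto simp: init)
    moreover have "0 \<le> a * (B1 * B2)" using a_pos B0 by simp
    ultimately show ?thesis
      using D(5-7) D(2-4)[OF t] B[of n] B0 unfolding R_def init by auto
  qed
  have R: "0 \<le> R" using box[of 0 0] by simp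
  obtain v where v0: "v 0 = (x0, y0, 1)"
    and v: "\<And>T t. t \<in> {0..T} \<Longrightarrow> (v has_vector_derivative field R (v t)) (at t within {0..T})"
    by (rule truncated_flow[OF R]) blast
  have lim: "(\<lambda>n. (x n t, y n t, z n t)) \<longlonglongrightarrow> v t" if t: "0 \<le> t" for t
  proof (rule metric_tendsto_imp_tendsto)
    have "(\<lambda>n. (X n, Y n, 1)) \<longlonglongrightarrow> v 0"
      unfolding v0 by (intro tendsto_intros X Y)
    then have "(\<lambda>n. dist (X n, Y n, 1) (v 0)) \<longlonglongrightarrow> 0" by (rule tendsto_dist_iff[THEN iffD1])
    then show "(\<lambda>n. exp ((2 + 2 * b * R + 2 * a * R) * t) * dist (X n, Y n, 1) (v 0)) \<longlonglongrightarrow> 0"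
      by (rule tendsto_mult_right_zero)
    show "\<forall>\<^sub>F n in sequentially. dist (x n t, y n t, z n t) (v t)
        \<le> dist (exp ((2 + 2 * b * R + 2 * a * R) * t) * dist (X n, Y n, 1) (v 0)) 0"
    proof (rule always_eventually, rule)
      fix n
      have "dist (x n t, y n t, z n t) (v t)
          \<le> exp ((2 + 2 * b * R + 2 * a * R) * t) * dist (x n 0, y n 0, z n 0) (v 0)"
      proof (rule sol_eq_truncated_flow[OF decayingD(1)[OF xyz[of n], of t] _ v])
        fix s assume "s \<in> {0..t}"
        then show "\<bar>x n s\<bar> \<le> R \<and> \<bar>y n s\<bar> \<le> R \<and> \<bar>z n s\<bar> \<le> R" using box[of s n] by auto
      qed (use t in auto)
      then show "dist (x n t, y n t, z n t) (v t)
        \<le> dist (exp ((2 + 2 * b * R + 2 * a * R) * t) * dist (X n, Y n, 1) (v 0)) 0"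
        by (simp add: init)
    qed
  qed
  have box_v: "0 \<le> fst (v t) \<and> fst (v t) \<le> R \<and> - R \<le> fst (snd (v t)) \<and> fst (snd (v t)) \<le> 0 \<and>
      0 \<le> snd (snd (v t)) \<and> snd (snd (v t)) \<le> R" if t: "0 \<le> t" for t
  proof -
    note lims = tendsto_fst[OF lim[OF t]] tendsto_fst[OF tendsto_snd[OF lim[OF t]]]
      tendsto_snd[OF tendsto_snd[OF lim[OF t]]]
    show ?thesis
      using LIMSEQ_le_const[OF lims(1), of 0] LIMSEQ_le_const2[OF lims(1), of R]
        LIMSEQ_le_const[OF lims(2), of "- R"] LIMSEQ_le_const2[OF lims(2), of 0]
        LIMSEQ_le_const[OF lims(3), of 0] LIMSEQ_le_const2[OF lims(3), of R] box[OF t] by simp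
  qed
  have "decaying (\<lambda>t. fst (v t)) (\<lambda>t. fst (snd (v t))) (\<lambda>t. snd (snd (v t)))"
  proof (rule decaying_of_weak_signs)
    show "sol T (\<lambda>t. fst (v t)) (\<lambda>t. fst (snd (v t))) (\<lambda>t. snd (snd (v t)))" for T
    proof (rule sol_of_vector_derivative[OF v])
      fix t assume "t \<in> {0..T}"
      then show "\<bar>fst (v t)\<bar> \<le> R \<and> \<bar>fst (snd (v t))\<bar> \<le> R \<and> \<bar>snd (snd (v t))\<bar> \<le> R"
        using box_v[of t] by auto
    qed
  qed (use box_v v0 in auto)
  then show ?thesis unfolding decaying_data_def using v0 by fastforce
qed

text \<open>Run the negated field for a short time \<open>t\<close>, during which the signs, the box
  and the open condition \<open>G > 0\<close> persist, then flow forward from the point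
  reached.\<close>

lemma decaying_extend_backward:
  fixes G :: "real \<times> real \<times> real \<Rightarrow> real"
  assumes dec: "decaying x y z" and G: "continuous_on UNIV G" "0 < G (x 0, y 0, z 0)"
  obtains t X Y Z where "0 < t" "decaying X Y Z" "X t = x 0" "Y t = y 0" "Z t = z 0"
    "\<And>s. s \<in> {0..t} \<Longrightarrow> 0 < G (X s, Y s, Z s)"
proof -
  note D = decayingD[OF dec]
  define R where "R = x 0 - y 0 + z 0 + a * x 0 * - y 0 + 1"
  have "0 \<le> a * x 0 * - y 0" using a_pos D(2)[of 0] D(3)[of 0] by (intro mult_nonneg_nonneg) auto
  then have R: "0 \<le> R" "x 0 < R" "- y 0 < R" "z 0 < R" "a * x 0 * - y 0 < R"
    using D(2-4)[of 0] unfolding R_def by linarith+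
  have lip: "(2 + 2 * b * R + 2 * a * R)-lipschitz_on UNIV (\<lambda>v. - field R v)"
    using lipschitz_field[OF R(1)] by (rule lipschitz_on_minus)
  obtain v where v0: "v 0 = (x 0, y 0, z 0)"
    and v: "\<And>T t. t \<in> {0..T} \<Longrightarrow> (v has_vector_derivative - field R (v t)) (at t within {0..T})"
    using picard_lindeloef_global[OF lip, of "(x 0, y 0, z 0)"] by blast
  define U where "U w = min (min (fst w) (min (- fst (snd w)) (snd (snd w))))
    (min (min (R - fst w) (R + fst (snd w))) (min (R - snd (snd w)) (G w)))" for w
  have U0: "0 < U (v 0)"
    using D(2-4)[of 0] R G(2) by (simp add: U_def v0)
  have v_cont: "continuous_on {0..1} v"
    unfolding continuous_on_eq_continuous_within by (meson v has_vector_derivative_continuous)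
  have "continuous_on UNIV U" unfolding U_def by (intro continuous_intros G(1))
  then have "continuous_on {0..1} (\<lambda>t. U (v t))"
    by (rule continuous_on_compose2[OF _ v_cont]) simp
  then have "\<exists>d>0. \<forall>t\<in>{0..1}. dist t 0 < d \<longrightarrow> dist (U (v t)) (U (v 0)) < U (v 0)"
    using U0 unfolding continuous_on_iff by (meson atLeastAtMost_iff order_refl zero_le_one)
  then obtain d where d: "0 < d" "\<And>t. t \<in> {0..1} \<Longrightarrow> dist t 0 < d \<Longrightarrow> dist (U (v t)) (U (v 0)) < U (v 0)"
    by blast
  define t where "t = min 1 (d / 2)"
  have t: "0 < t" "t \<le> 1" "t < d" using d(1) by (auto simp: t_def)
  have U: "0 < U (v s)" if "s \<in> {0..t}" for s
    using d(2)[of s] that t by (auto simp: dist_real_def)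
  obtain w where w0: "w 0 = v t"
    and w: "\<And>T t. t \<in> {0..T} \<Longrightarrow> (w has_vector_derivative field R (w t)) (at t within {0..T})"
    by (rule truncated_flow[OF R(1)]) blast
  \<comment> \<open>By Gronwall the forward flow first retraces the reversed one and then follows
    the given solution.\<close>
  have w_v: "w s = v (t - s)" if s: "s \<in> {0..t}" for s
  proof -
    have "dist (w s) (v (t - s)) \<le> exp ((2 + 2 * b * R + 2 * a * R) * s) * dist (w 0) (v (t - 0))"
    proof (rule gronwall[OF lipschitz_field[OF R(1)] w _ s, where y = "\<lambda>s. v (t - s)"])
      fix r assume r: "r \<in> {0..t}"
      have img: "(\<lambda>s. t - s) ` {0..t} = {0..t}" by simp
      have "((\<lambda>s. t - s) has_vector_derivative - 1) (at r within {0..t})"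
        by (auto intro!: derivative_eq_intros)
      moreover have "(v has_vector_derivative - field R (v (t - r))) (at (t - r) within (\<lambda>s. t - s) ` {0..t})"
        unfolding img by (rule v) (use r in auto)
      ultimately have "(v \<circ> (\<lambda>s. t - s) has_vector_derivative (- 1) *\<^sub>R - field R (v (t - r))) (at r within {0..t})"
        by (rule vector_diff_chain_within)
      then show "((\<lambda>s. v (t - s)) has_vector_derivative field R (v (t - r))) (at r within {0..t})"
        by (simp add: o_def)
    qed
    then show ?thesis using w0 by simp
  qed
  have w_dec: "w (t + s) = (x s, y s, z s)" if s: "0 \<le> s" for s
  proof -
    have "dist (x s, y s, z s) (w (t + s))
        \<le> exp ((2 + 2 * b * R + 2 * a * R) * s) * dist (x 0, y 0, z 0) (w (t + 0))"
    proof (rule sol_eq_truncated_flow[OF D(1)[of s], where v = "\<lambda>s. w (t + s)"])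
      fix r assume r: "r \<in> {0..s}"
      show "\<bar>x r\<bar> \<le> R \<and> \<bar>y r\<bar> \<le> R \<and> \<bar>z r\<bar> \<le> R"
        using decaying_box[OF dec, of r] D(2-4)[of r] r R by auto
      have "((\<lambda>s. t + s) has_vector_derivative 1) (at r within {0..s})"
        by (auto intro!: derivative_eq_intros)
      moreover have "(w has_vector_derivative field R (w (t + r))) (at (t + r) within (\<lambda>s. t + s) ` {0..s})"
        by (rule has_vector_derivative_within_subset[OF w[of _ "t + s"]]) (use r t in auto)
      ultimately have "(w \<circ> (\<lambda>s. t + s) has_vector_derivative 1 *\<^sub>R field R (w (t + r))) (at r within {0..s})"
        by (rule vector_diff_chain_within)
      then show "((\<lambda>s. w (t + s)) has_vector_derivative field R (w (t + r))) (at r within {0..s})"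
        by (simp add: o_def)
    qed (use s in auto)
    moreover have "w t = (x 0, y 0, z 0)" using w_v[of t] t v0 by simp
    ultimately show ?thesis by simp
  qed
  define X Y Z where "X s = fst (w s)" and "Y s = fst (snd (w s))" and "Z s = snd (snd (w s))" for s
  have box: "0 < X s \<and> X s \<le> R \<and> Y s < 0 \<and> - R \<le> Y s \<and> 0 < Z s \<and> Z s \<le> R" if "0 \<le> s" for s
  proof (cases "s \<le> t")
    case True
    then show ?thesis using U[of "t - s"] w_v[of s] that unfolding X_def Y_def Z_def U_def by auto
  next
    case False
    then show ?thesis
      using w_dec[of "s - t"] decaying_box[OF dec, of "s - t"] D(2-4)[of "s - t"] R
      unfolding X_def Y_def Z_def by auto
  qed
  have "sol T X Y Z" for T
    unfolding X_def Y_def Z_def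
  proof (rule sol_of_vector_derivative[OF w])
    fix s assume "s \<in> {0..T}"
    then show "\<bar>fst (w s)\<bar> \<le> R \<and> \<bar>fst (snd (w s))\<bar> \<le> R \<and> \<bar>snd (snd (w s))\<bar> \<le> R"
      using box[of s] unfolding X_def Y_def Z_def by auto
  qed
  then have "decaying X Y Z" using box unfolding decaying_def by blast
  moreover have "X t = x 0" "Y t = y 0" "Z t = z 0"
    using w_dec[of 0] by (simp_all add: X_def Y_def Z_def)
  moreover have "0 < G (X s, Y s, Z s)" if "s \<in> {0..t}" for s
    using U[of "t - s"] w_v[OF that] that unfolding X_def Y_def Z_def U_def by auto
  ultimately show thesis using that t by blast
qed

subsection \<open>The extremal solution\<close>

text \<open>At a decaying datum of maximal curvature the curvature is stationary: it cannot increase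
  forwards, nor, as decaying solutions extend backwards, in the other direction.\<close>

lemma maximal_curv_stationary:
  assumes dec: "decaying x y z"
    and max: "\<And>p q r. decaying_data p q r \<Longrightarrow> r / p ^ 3 \<le> curv x z 0"
  shows "b * x 0 * (y 0)\<^sup>2 = a * (x 0)\<^sup>2 * z 0 + 3 * y 0 * z 0"
proof -
  \<comment> \<open>\<open>curv\<close> has derivative \<open>- G / x ^ 4\<close>, so
    \<open>G > 0\<close> means decreasing curvature; being an open condition, it persists on the
    backward extension.\<close>
  define G where "G w = a * (fst w)\<^sup>2 * snd (snd w) + 3 * fst (snd w) * snd (snd w)
    - b * fst w * (fst (snd w))\<^sup>2" for w :: "real \<times> real \<times> real"
  have K: "x t * (b * (slope x y t)\<^sup>2 - a * curv x z t + 3 * slope x y t * curv x z t)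
      = - G (x t, y t, z t) / x t ^ 4" if "0 < x t" for x y z t
    using that by (simp add: slope_def curv_def G_def field_simps eval_nat_numeral)
  have curv_le: "curv X Z t \<le> curv x z 0" if "decaying X Y Z" "0 \<le> t" for X Y Z t
    using max[OF decaying_data_rescale[OF that, of 1]] by (simp add: curv_def)
  have "\<not> 0 < G (x 0, y 0, z 0)"
  proof
    assume pos: "0 < G (x 0, y 0, z 0)"
    have cont: "continuous_on UNIV G" unfolding G_def by (intro continuous_intros)
    obtain t X Y Z where t: "0 < t" and XYZ: "decaying X Y Z"
      and at_t: "X t = x 0" "Y t = y 0" "Z t = z 0"
      and G: "\<And>s. s \<in> {0..t} \<Longrightarrow> 0 < G (X s, Y s, Z s)"
      by (rule decaying_extend_backward[OF dec cont pos]) blast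
    note D = decayingD[OF XYZ]
    have "- curv X Z 0 < - curv X Z t"
    proof (rule increasing_within[where a = 0 and b = t and f = "\<lambda>t. - curv X Z t"
          and f' = "\<lambda>s. G (X s, Y s, Z s) / X s ^ 4"])
      fix s assume s: "s \<in> {0..t}"
      show "((\<lambda>t. - curv X Z t) has_real_derivative G (X s, Y s, Z s) / X s ^ 4) (at s within {0..t})"
        using DERIV_minus[OF curv_deriv[OF D(1) s D(2)]] K[of X s Y Z] D(2)[of s] s by simp
    next
      fix s assume "s \<in> {0<..<t}"
      then show "0 < G (X s, Y s, Z s) / X s ^ 4" using G[of s] D(2)[of s] by simp
    qed (use t in auto)
    moreover have "curv X Z t = curv x z 0" by (simp add: curv_def at_t)
    ultimately show False using curv_le[OF XYZ, of 0] by simp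
  qed
  moreover have "\<not> G (x 0, y 0, z 0) < 0"
  proof
    assume neg: "G (x 0, y 0, z 0) < 0"
    have x0: "0 < x 0" by (rule decayingD(2)[OF dec order_refl])
    have "(curv x z has_real_derivative - G (x 0, y 0, z 0) / x 0 ^ 4) (at 0 within {0..1})"
      using curv_deriv[OF decayingD(1)[OF dec], of 0 1] x0 K[of x 0 y z] by simp
    moreover have "0 < - G (x 0, y 0, z 0) / x 0 ^ 4" using neg x0 by (simp add: divide_neg_pos)
    ultimately have "\<exists>d>0. \<forall>h>0. 0 + h \<in> {0..1} \<longrightarrow> h < d \<longrightarrow> curv x z 0 < curv x z (0 + h)"
      by (rule has_real_derivative_pos_inc_right)
    then obtain d where d: "0 < d"
      "\<And>h. 0 < h \<Longrightarrow> 0 + h \<in> {0..1} \<Longrightarrow> h < d \<Longrightarrow> curv x z 0 < curv x z (0 + h)"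
      by blast
    have "curv x z 0 < curv x z (min 1 (d / 2))"
      using d(2)[of "min 1 (d / 2)"] d(1) by auto
    then show False using curv_le[OF dec, of "min 1 (d / 2)"] d(1) by simp
  qed
  ultimately show ?thesis by (simp add: G_def)
qed

text \<open>Along a minimising sequence of heights the values of \<open>y\<close> are bounded by
  \<open>decaying_slope_bound\<close>; a convergent subsequence and
  \<open>decaying_data_closed\<close> give a minimiser.\<close>

lemma minimal_height_ex:
  obtains c y0 where "0 < c" "decaying_data c y0 1" "\<forall>p q. decaying_data p q 1 \<longrightarrow> c \<le> p"
proof -
  define \<Gamma> where "\<Gamma> = {p. \<exists>q. decaying_data p q 1}"
  define c where "c = Inf \<Gamma>"
  have pos: "0 < p" if "p \<in> \<Gamma>" for p
    using that decayingD(2) unfolding \<Gamma>_def decaying_data_def by fastforce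
  have ne: "\<Gamma> \<noteq> {}" using decaying_data_ex unfolding \<Gamma>_def by blast
  have bdd: "bdd_below \<Gamma>" using pos by (meson bdd_belowI less_imp_le)
  have c_le: "c \<le> p" if "decaying_data p q 1" for p q
    unfolding c_def by (rule cInf_lower[OF _ bdd]) (use that in \<open>auto simp: \<Gamma>_def\<close>)
  have "\<exists>p q. decaying_data p q 1 \<and> p < c + 1 / real (Suc n)" for n
  proof -
    have "Inf \<Gamma> < c + 1 / real (Suc n)" by (simp add: c_def)
    then obtain p where "p \<in> \<Gamma>" "p < c + 1 / real (Suc n)" using cInf_lessD[OF ne] by blast
    then show ?thesis unfolding \<Gamma>_def by blast
  qed
  then obtain p q where pq: "\<And>n. decaying_data (p n) (q n) 1" "\<And>n. p n < c + 1 / real (Suc n)"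
    by metis
  have "p \<longlonglongrightarrow> c"
  proof (rule real_tendsto_sandwich[of "\<lambda>_. c" _ _ "\<lambda>n. c + 1 / real (Suc n)"])
    show "(\<lambda>n. c + 1 / real (Suc n)) \<longlonglongrightarrow> c"
      using tendsto_add[OF tendsto_const LIMSEQ_inverse_real_of_nat, of c] by (simp add: inverse_eq_divide)
    show "\<forall>\<^sub>F n in sequentially. c \<le> p n" using c_le[OF pq(1)] by simp
    show "\<forall>\<^sub>F n in sequentially. p n \<le> c + 1 / real (Suc n)"
      using pq(2) by (simp add: less_imp_le)
  qed simp
  have q: "q n \<in> {- (a / 2 * (c + 1)\<^sup>2)..0}" for n
  proof -
    obtain x y z where dec: "decaying x y z" "x 0 = p n" "y 0 = q n"
      using pq(1)[of n] unfolding decaying_data_def by blast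
    have "1 / real (Suc n) \<le> 1" by simp
    then have "p n \<le> c + 1" using pq(2)[of n] by linarith
    moreover have "0 < p n" using decayingD(2)[OF dec(1), of 0] dec(2) by simp
    ultimately have "a / 2 * (p n)\<^sup>2 \<le> a / 2 * (c + 1)\<^sup>2"
      using a_pos by (intro mult_left_mono power_mono) auto
    then show ?thesis
      using decaying_slope_bound[OF dec(1), of 0] decayingD(3)[OF dec(1), of 0] dec by auto
  qed
  have "seq_compact {- (a / 2 * (c + 1)\<^sup>2)..0}"
    by (rule compact_imp_seq_compact[OF compact_Icc])
  then obtain y0 r where r: "strict_mono (r :: nat \<Rightarrow> nat)" "(q \<circ> r) \<longlonglongrightarrow> y0"
    using q by (metis seq_compactE)
  have "decaying_data c y0 1"
  proof (rule decaying_data_closed)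
    show "decaying_data ((p \<circ> r) n) ((q \<circ> r) n) 1" for n using pq(1) by simp
    show "(p \<circ> r) \<longlonglongrightarrow> c" using LIMSEQ_subseq_LIMSEQ[OF \<open>p \<longlonglongrightarrow> c\<close> r(1)] .
  qed (rule r(2))
  moreover have "0 < c" using pos[of c] \<open>decaying_data c y0 1\<close> unfolding \<Gamma>_def by blast
  ultimately show thesis using that c_le by blast
qed

text \<open>Once \<open>z\<close> is normalised to \<open>1\<close>, curvature is the inverse cube
  of the height, so least height means greatest curvature, which is stationary. As
  \<open>b > 2 * a\<close> and \<open>y0 < 0\<close>, the resulting equation places the datum in the
  convexity region.\<close>

lemma minimal_height_slope:
  assumes c: "\<forall>p q. decaying_data p q 1 \<longrightarrow> c \<le> p" and "0 < c" and dec: "decaying_data c y0 1"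
  shows "y0 < 0" "b * c * y0\<^sup>2 = a * c\<^sup>2 + 3 * y0" "2 * y0\<^sup>2 < c"
proof -
  obtain x y z where xyz: "decaying x y z" "x 0 = c" "y 0 = y0" "z 0 = 1"
    using dec unfolding decaying_data_def by blast
  have max: "r / p ^ 3 \<le> curv x z 0" if pqr: "decaying_data p q r" for p q r
  proof -
    obtain u v w where uvw: "decaying u v w" "u 0 = p" "w 0 = r"
      using pqr unfolding decaying_data_def by blast
    obtain k where k: "0 < k" "k ^ 3 * r = 1" "decaying_data (k * p) (k ^ 2 * v 0) 1"
      using decaying_data_normalise[OF uvw(1) order_refl] uvw by auto
    have p: "0 < p" and r: "0 < r" using decayingD(2,4)[OF uvw(1), of 0] uvw by auto
    have "c ^ 3 * r \<le> (k * p) ^ 3 * r"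
      using c k(3) \<open>0 < c\<close> r by (intro mult_right_mono power_mono) auto
    also have "\<dots> = p ^ 3" using k(2) by (simp add: power_mult_distrib mult_ac)
    finally show ?thesis using p \<open>0 < c\<close> xyz by (simp add: curv_def field_simps)
  qed
  show y0: "y0 < 0" using decayingD(3)[OF xyz(1), of 0] xyz by simp
  show eq: "b * c * y0\<^sup>2 = a * c\<^sup>2 + 3 * y0"
    using maximal_curv_stationary[OF xyz(1) max] xyz by simp
  have "a * (c * (2 * y0\<^sup>2)) \<le> b * c * y0\<^sup>2" using \<open>0 < c\<close> by (simp add: b_eq algebra_simps)
  also have "\<dots> < a * (c * c)" using eq y0 by (simp add: power2_eq_square)
  finally show "2 * y0\<^sup>2 < c" using a_pos \<open>0 < c\<close> by (simp add: mult_less_cancel_left_pos)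
qed

text \<open>The stationarity equation is quadratic in \<open>y0\<close>: two distinct roots would
  have the positive sum \<open>3 / (b * c)\<close>, but both values are negative.\<close>

lemma minimal_height_slope_unique:
  assumes c: "\<forall>p q. decaying_data p q 1 \<longrightarrow> c \<le> p" and "0 < c"
    and "decaying_data c y0 1" "decaying_data c y1 1"
  shows "y0 = y1"
proof (rule ccontr)
  assume ne: "y0 \<noteq> y1"
  note A = minimal_height_slope[OF c \<open>0 < c\<close> assms(3)] and B = minimal_height_slope[OF c \<open>0 < c\<close> assms(4)]
  have "(y0 - y1) * (b * c * (y0 + y1) - 3) = (b * c * y0\<^sup>2 - 3 * y0) - (b * c * y1\<^sup>2 - 3 * y1)"
    by (simp add: algebra_simps power2_eq_square)
  also have "\<dots> = 0" using A(2) B(2) by simp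
  finally have "b * c * (y0 + y1) = 3" using ne by simp
  moreover have "b * c * (y0 + y1) < 0"
    using A(1) B(1) \<open>0 < c\<close> a_pos b_eq by (intro mult_pos_neg) (auto intro: add_neg_neg)
  ultimately show False by simp
qed

section \<open>Heights above the minimum\<close>

lemma infinite_slopes_above_minimum:
  assumes c: "\<forall>p q. decaying_data p q 1 \<longrightarrow> c \<le> p" and "0 < c" and dec: "decaying_data c y0 1"
    and g: "c < g"
  shows "infinite {q. decaying_data g q 1}"
proof -
  obtain x y z where xyz: "decaying x y z" "x 0 = c" "y 0 = y0" "z 0 = 1"
    using dec unfolding decaying_data_def by blast
  note D = decayingD[OF xyz(1)]
  have E: "2 * (y 0)\<^sup>2 < x 0 * z 0" using minimal_height_slope(3)[OF c \<open>0 < c\<close> dec] xyz by simp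
  have g0: "0 < g" using \<open>0 < c\<close> g by simp
  \<comment> \<open>Curvature of any datum with height \<open>g\<close> and
    \<open>z = 1\<close>.\<close>
  define h where "h = 1 / g ^ 3"
  have h: "0 < h" "h < curv x z 0"
    using g \<open>0 < c\<close> xyz by (auto simp: h_def curv_def intro!: divide_strict_left_mono power_strict_mono)
  \<comment> \<open>By \<open>decaying_curv_less\<close>, a slope below \<open>h / a\<close> forces
    the curvature below \<open>h\<close>: the orbit reaches that level, first at time
    \<open>s\<close>.\<close>
  obtain t where t: "0 \<le> t" "slope x y t < h / a"
    by (rule decaying_slope_small[OF xyz(1) E, of "h / a"]) (use h a_pos in auto)
  have end_le: "curv x z t - h \<le> 0"
    using decaying_curv_less[OF xyz(1) t(1)] t(2) a_pos by (simp add: field_simps)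
  have cont: "continuous_on {0..T} (slope x y)" "continuous_on {0..T} (curv x z)" for T
    by (rule slope_curv_continuous[OF D(1)], use D(2) in auto)+
  have "continuous_on {0..t} (\<lambda>t. curv x z t - h)" by (intro continuous_intros cont)
  then obtain s where s: "0 < s" "curv x z s - h = 0"
    "\<And>r. 0 \<le> r \<Longrightarrow> r < s \<Longrightarrow> 0 < curv x z r - h"
    by (rule first_zero[where u = "\<lambda>t. curv x z t - h", OF _ _ t(1) end_le]) (use h in auto)
  have "2 * (slope x y s)\<^sup>2 < curv x z s"
    using decaying_convexity[OF xyz(1) E, of s] convexity_iff[of x s y z] D(2)[of s] s by simp
  then have pos: "0 < h - 2 * (slope x y s)\<^sup>2" using s(2) by simp
  have "continuous_on {0..s} (\<lambda>t. h - 2 * (slope x y t)\<^sup>2)" by (intro continuous_intros cont)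
  then have "\<exists>d>0. \<forall>t\<in>{0..s}. dist t s < d \<longrightarrow>
      dist (h - 2 * (slope x y t)\<^sup>2) (h - 2 * (slope x y s)\<^sup>2) < h - 2 * (slope x y s)\<^sup>2"
    using pos s(1) unfolding continuous_on_iff by (meson atLeastAtMost_iff less_imp_le order_refl)
  then obtain d where d: "0 < d" "\<And>t. t \<in> {0..s} \<Longrightarrow> dist t s < d \<Longrightarrow>
      dist (h - 2 * (slope x y t)\<^sup>2) (h - 2 * (slope x y s)\<^sup>2) < h - 2 * (slope x y s)\<^sup>2"
    by blast
  \<comment> \<open>Start of a window before \<open>s\<close> on which \<open>h\<close> still
    exceeds \<open>2 P^2\<close>; there each point of the orbit can be lowered to level
    \<open>h\<close> within the convexity region.\<close>
  define r where "r = max 0 (s - d / 2)"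
  have r: "0 \<le> r" "r < s" "s - d < r" using s(1) d(1) by (auto simp: r_def)
  define q where "q t = - (g\<^sup>2 * slope x y t)" for t
  have "decaying_data g (q t) 1" if t: "t \<in> {r..<s}" for t
  proof -
    have t0: "0 \<le> t" and xt: "0 < x t" using t r D(2)[of t] by auto
    \<comment> \<open>Rescaling brings the height to \<open>g\<close>; then \<open>z\<close> is at
      least \<open>1\<close>, and the comparison lemma lowers it to \<open>1\<close>.\<close>
    define k where "k = g / x t"
    have k: "0 < k" using g0 xt by (simp add: k_def)
    have kx: "k * x t = g" using xt by (simp add: k_def)
    have ky: "k ^ 2 * y t = q t"
      using xt by (simp add: k_def q_def slope_def power_divide)
    have kz: "k ^ 3 * z t = g ^ 3 * curv x z t"
      using xt by (simp add: k_def curv_def power_divide)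
    have "2 * (slope x y t)\<^sup>2 < h"
      using d(2)[of t] t r by (auto simp: dist_real_def)
    then have "g ^ 4 * (2 * (slope x y t)\<^sup>2) < g ^ 4 * h" using g0 by (intro mult_strict_left_mono) auto
    then have 1: "2 * (q t)\<^sup>2 < g * 1"
      using g0 by (simp add: q_def h_def power_mult_distrib eval_nat_numeral mult_ac)
    have "g ^ 3 * h \<le> g ^ 3 * curv x z t"
      using s(3)[OF t0] t g0 by (intro mult_left_mono) auto
    then have 2: "1 \<le> k ^ 3 * z t" using g0 by (simp add: kz h_def)
    show ?thesis
      using decaying_data_comparison[OF decaying_rescale[OF xyz(1) t0 k], of 1] 1 2
      by (simp add: kx ky)
  qed
  then have "q ` {r..<s} \<subseteq> {q. decaying_data g q 1}" by blast
  moreover have "inj_on q {r..<s}"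
  proof (rule linorder_inj_onI')
    fix i j assume ij: "i \<in> {r..<s}" "j \<in> {r..<s}" "i < j"
    have "slope x y j < slope x y i"
      by (rule slope_antimono[OF D(1)[of j]])
        (use ij r D(2) decaying_convexity[OF xyz(1) E] in auto)
    then show "q i \<noteq> q j" using g0 by (simp add: q_def)
  qed
  ultimately show ?thesis
    using r(2) by (meson finite_imageD finite_subset infinite_Ico)
qed

section \<open>Passage to the boundary value problem\<close>

text \<open>Since \<open>z > 0\<close>, \<open>y\<close> increases to its limit \<open>0\<close>, so
  \<open>y \<le> 0\<close>. If \<open>x\<close> were negative at \<open>t\<close>, it would stay so,
  \<open>z\<close> could no longer decrease, and \<open>y\<close> would grow linearly and become
  positive.\<close>

lemma decaying_of_limit:
  assumes sol: "\<And>T. sol T x y z" and z0: "0 < z 0" and lim: "(y \<longlongrightarrow> 0) at_top"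
  shows "decaying x y z"
proof (rule decaying_of_weak_signs[OF sol z0])
  have z: "0 < z t" if "0 \<le> t" for t
    by (rule sol_z_pos[OF sol[of t]]) (use z0 that in auto)
  have mono: "y s \<le> y t" if "0 \<le> s" "s \<le> t" for s t
    by (rule sol_y_mono[OF sol[of t]]) (use z that in \<open>auto simp: less_imp_le\<close>)
  show y: "y s \<le> 0" if "0 \<le> s" for s
  proof (rule tendsto_lowerbound[OF lim])
    show "\<forall>\<^sub>F t in at_top. y s \<le> y t"
      using mono[OF that] unfolding eventually_at_top_linorder by blast
  qed simp
  fix t :: real assume t: "0 \<le> t"
  show "0 \<le> x t"
  proof (rule ccontr)
    assume neg: "\<not> 0 \<le> x t"
    \<comment> \<open>Growing at rate at least \<open>z t\<close>, \<open>y\<close> gains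
      \<open>1 - y t\<close> by this time, so \<open>y T \<ge> 1\<close>.\<close>
    define T where "T = t + (1 - y t) / z t"
    have T: "t < T" using z[OF t] y[OF t] by (simp add: T_def)
    have x: "x s \<le> 0" if "t \<le> s" for s
      using sol_x_antimono[OF sol[of s], of t s] y t neg that by auto
    have z_ge: "z t \<le> z s" if s: "t \<le> s" for s
    proof (rule nondecreasing_within[where a = t and b = s and f = z])
      fix r assume r: "r \<in> {t..s}"
      show "(z has_real_derivative b * (y r)\<^sup>2 - a * x r * z r) (at r within {t..s})"
        by (rule has_field_derivative_subset[OF solD(3)[OF sol[of s]]]) (use r t in auto)
      have "a * x r * z r \<le> 0"
        using x[of r] z[of r] r t a_pos by (simp add: mult_nonneg_nonpos mult_nonpos_nonneg)
      moreover have "0 \<le> b * (y r)\<^sup>2" using a_pos b_eq by simp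
      ultimately show "0 \<le> b * (y r)\<^sup>2 - a * x r * z r" by linarith
    qed (use s in auto)
    have "y t - z t * t \<le> y T - z t * T"
    proof (rule nondecreasing_within[where a = t and b = T and f' = "\<lambda>s. z s - z t"
          and f = "\<lambda>s. y s - z t * s"])
      fix r assume r: "r \<in> {t..T}"
      have "(y has_real_derivative z r) (at r within {t..T})"
        by (rule has_field_derivative_subset[OF solD(2)[OF sol[of T]]]) (use r t in auto)
      then show "((\<lambda>s. y s - z t * s) has_real_derivative z r - z t) (at r within {t..T})"
        by (auto intro!: derivative_eq_intros)
      show "0 \<le> z r - z t" using z_ge[of r] r by simp
    qed (use T in auto)
    moreover have "z t * T = z t * t + (1 - y t)"
      using z[OF t] by (simp add: T_def distrib_left)
    ultimately show False using y[of T] T t by simp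
  qed
qed

text \<open>Lets a solution be replaced by its restriction to \<open>{0..}\<close>.\<close>

lemma decaying_cong:
  assumes dec: "decaying x y z" and eq: "\<And>t. 0 \<le> t \<Longrightarrow> x' t = x t"
  shows "decaying x' y z"
proof -
  have "sol T x' y z" for T
    unfolding sol_def
  proof
    fix t assume t: "t \<in> {0..T}"
    note S = solD[OF decayingD(1)[OF dec] t]
    have "(x' has_real_derivative y t) (at t within {0..T})"
      using has_derivative_transform[OF t, of x' x] eq S(1)
      unfolding has_field_derivative_def by auto
    then show "(x' has_real_derivative y t) (at t within {0..T}) \<and>
        (y has_real_derivative z t) (at t within {0..T}) \<and>
        (z has_real_derivative b * (y t)\<^sup>2 - a * x' t * z t) (at t within {0..T})"
      using S eq[of t] t by simp
  qed
  then show ?thesis using decayingD[OF dec] eq unfolding decaying_def by simp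
qed

end

text \<open>Substituting \<open>x = - f\<close> turns the problem into the flow; the condition at
  infinity is exchanged for the signs by \<open>decaying_of_limit\<close> and
  \<open>decaying_y_tendsto_0\<close>.\<close>

lemma bvp_solution_iff_decaying:
  assumes "m < -2"
  defines "a \<equiv> - (m + 2)" and "b \<equiv> - (2 * m + 1)"
  shows "bvp_solution m \<gamma> f \<longleftrightarrow>
    (\<exists>y z. flow.decaying a b (\<lambda>t. - f t) y z \<and> f 0 = - \<gamma> \<and> z 0 = 1)"
proof -
  interpret flow a b by unfold_locales (use assms in auto)
  show ?thesis
  proof
    assume "bvp_solution m \<gamma> f"
    then obtain f1 f2 f3 where
      f: "\<forall>t\<ge>0. (f has_real_derivative f1 t) (at t within {0..})"
        "\<forall>t\<ge>0. (f1 has_real_derivative f2 t) (at t within {0..})"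
        "\<forall>t\<ge>0. (f2 has_real_derivative f3 t) (at t within {0..})"
      and ode: "\<forall>t\<ge>0. f3 t + (m + 2) * f t * f2 t - (2 * m + 1) * (f1 t)\<^sup>2 = 0"
      and bc: "f 0 = - \<gamma>" "f2 0 = - 1" "(f1 \<longlongrightarrow> 0) at_top"
      unfolding bvp_solution_def by blast
    have "sol T (\<lambda>t. - f t) (\<lambda>t. - f1 t) (\<lambda>t. - f2 t)" for T
      unfolding sol_def
    proof
      fix t assume t: "t \<in> {0..T}"
      have f3: "- f3 t = b * (- f1 t)\<^sup>2 - a * - f t * - f2 t"
        using ode t by (simp add: a_def b_def algebra_simps)
      then show "((\<lambda>t. - f t) has_real_derivative - f1 t) (at t within {0..T}) \<and>
        ((\<lambda>t. - f1 t) has_real_derivative - f2 t) (at t within {0..T}) \<and>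
        ((\<lambda>t. - f2 t) has_real_derivative b * (- f1 t)\<^sup>2 - a * - f t * - f2 t) (at t within {0..T})"
        using f[unfolded has_real_derivative_iff_all_intervals] t
        unfolding f3[symmetric] by (blast intro: DERIV_minus)
    qed
    then have "decaying (\<lambda>t. - f t) (\<lambda>t. - f1 t) (\<lambda>t. - f2 t)"
      by (rule decaying_of_limit) (use bc tendsto_minus[OF bc(3)] in auto)
    then show "\<exists>y z. decaying (\<lambda>t. - f t) y z \<and> f 0 = - \<gamma> \<and> z 0 = 1"
      using bc by (intro exI[of _ "\<lambda>t. - f1 t"] exI[of _ "\<lambda>t. - f2 t"]) simp
  next
    assume "\<exists>y z. decaying (\<lambda>t. - f t) y z \<and> f 0 = - \<gamma> \<and> z 0 = 1"
    then obtain y z where dec: "decaying (\<lambda>t. - f t) y z" and init: "f 0 = - \<gamma>" "z 0 = 1" by blast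
    define f3 where "f3 t = - (b * (y t)\<^sup>2 - a * - f t * z t)" for t
    note S = solD[OF decayingD(1)[OF dec]]
    have "\<forall>T. \<forall>t\<in>{0..T}. (f has_real_derivative - y t) (at t within {0..T})"
      using DERIV_minus[OF S(1)] by simp
    moreover have "\<forall>T. \<forall>t\<in>{0..T}. ((\<lambda>t. - y t) has_real_derivative - z t) (at t within {0..T})"
      using DERIV_minus[OF S(2)] by simp
    moreover have "\<forall>T. \<forall>t\<in>{0..T}. ((\<lambda>t. - z t) has_real_derivative f3 t) (at t within {0..T})"
      using DERIV_minus[OF S(3)] by (simp add: f3_def)
    moreover have "\<forall>t\<ge>0. f3 t + (m + 2) * f t * - z t - (2 * m + 1) * (- y t)\<^sup>2 = 0"
      by (simp add: f3_def a_def b_def algebra_simps)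
    moreover have "((\<lambda>t. - y t) \<longlongrightarrow> 0) at_top"
      using tendsto_minus[OF decaying_y_tendsto_0[OF dec]] by simp
    ultimately show "bvp_solution m \<gamma> f"
      unfolding bvp_solution_def has_real_derivative_iff_all_intervals[symmetric] using init
      by (intro exI[of _ "\<lambda>t. - y t"] exI[of _ "\<lambda>t. - z t"] exI[of _ f3]) simp
  qed
qed

theorem theorem3p1:
  fixes m :: real
  assumes "m < -2"
  shows "\<exists>\<gamma>\<^sub>0 :: real. \<forall>\<gamma> :: real.
           (\<gamma> > \<gamma>\<^sub>0 \<longrightarrow> infinite (bvp_solutions m \<gamma>)) \<and>
           (\<gamma> = \<gamma>\<^sub>0 \<longrightarrow> (\<exists>!f. f \<in> bvp_solutions m \<gamma>)) \<and>
           (\<gamma> < \<gamma>\<^sub>0 \<longrightarrow> bvp_solutions m \<gamma> = {})"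
proof -
  define a b where "a = - (m + 2)" and "b = - (2 * m + 1)"
  interpret flow a b by unfold_locales (use assms in \<open>auto simp: a_def b_def\<close>)
  note bvp = bvp_solution_iff_decaying[OF assms, folded a_def b_def]
  obtain c y0 where c: "0 < c" "decaying_data c y0 1" "\<forall>p q. decaying_data p q 1 \<longrightarrow> c \<le> p"
    by (rule minimal_height_ex)
  have data: "decaying_data \<gamma> (y 0) 1"
    if "decaying (\<lambda>t. - f t) y z" "f 0 = - \<gamma>" "z 0 = 1" for \<gamma> f y z
    using that unfolding decaying_data_def by fastforce
  have pick: "\<exists>f y z. f \<in> bvp_solutions m \<gamma> \<and> decaying (\<lambda>t. - f t) y z \<and> y 0 = q"
    if q: "decaying_data \<gamma> q 1" for \<gamma> q
  proof -
    obtain x y z where xyz: "decaying x y z" "x 0 = \<gamma>" "y 0 = q" "z 0 = 1"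
      using q unfolding decaying_data_def by blast
    \<comment> \<open>\<open>restrict\<close> gives the default value outside \<open>{0..}\<close>
      that \<open>extensional\<close> demands.\<close>
    define f where "f = restrict (\<lambda>t. - x t) {0..}"
    have dec: "decaying (\<lambda>t. - f t) y z"
      by (rule decaying_cong[OF xyz(1)]) (simp add: f_def)
    moreover have "f 0 = - \<gamma>" by (simp add: f_def xyz)
    ultimately have "f \<in> bvp_solutions m \<gamma>"
      unfolding bvp_solutions_def bvp using xyz by (auto simp: f_def)
    then show ?thesis using dec xyz by blast
  qed
  have unique: "f = g" if f: "f \<in> bvp_solutions m c" and g: "g \<in> bvp_solutions m c" for f g
  proof -
    obtain y z where yz: "decaying (\<lambda>t. - f t) y z" "f 0 = - c" "z 0 = 1"
      using f unfolding bvp_solutions_def bvp by blast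
    obtain y' z' where yz': "decaying (\<lambda>t. - g t) y' z'" "g 0 = - c" "z' 0 = 1"
      using g unfolding bvp_solutions_def bvp by blast
    \<comment> \<open>At the least height the initial slope is determined, so both functions solve
      the same initial value problem.\<close>
    have y0: "y 0 = y' 0"
      by (rule minimal_height_slope_unique[OF c(3) c(1) data[OF yz] data[OF yz']])
    have "- f t = - g t" if "0 \<le> t" for t
      by (rule sol_unique(1)[OF decayingD(1)[OF yz(1), of t] decayingD(1)[OF yz'(1), of t]])
        (use y0 yz yz' that in auto)
    then show "f = g"
      using f g unfolding bvp_solutions_def by (intro extensionalityI[of f "{0..}"]) auto
  qed
  show ?thesis
  proof (intro exI[of _ c] allI conjI impI)
    fix \<gamma> assume "c < \<gamma>"
    then have inf: "infinite {q. decaying_data \<gamma> q 1}"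
      by (rule infinite_slopes_above_minimum[OF c(3) c(1,2)])
    obtain F Y Z where F: "\<And>q. decaying_data \<gamma> q 1 \<Longrightarrow>
        F q \<in> bvp_solutions m \<gamma> \<and> decaying (\<lambda>t. - F q t) (Y q) (Z q) \<and> Y q 0 = q"
      using pick by metis
    \<comment> \<open>The one-sided derivative at \<open>0\<close> recovers \<open>q\<close> from
      \<open>F q\<close>.\<close>
    have "inj_on F {q. decaying_data \<gamma> q 1}"
    proof (rule inj_onI)
      fix q q' assume q: "q \<in> {q. decaying_data \<gamma> q 1}" "q' \<in> {q. decaying_data \<gamma> q 1}"
        and eq: "F q = F q'"
      have deriv: "((\<lambda>t. - F q t) has_real_derivative q) (at 0 within {0..1})"
        if "decaying_data \<gamma> q 1" for q
        using solD(1)[OF decayingD(1), of "\<lambda>t. - F q t" "Y q" "Z q" 0 1] F[OF that] by simp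
      have "((\<lambda>t. - F q t) has_real_derivative q) (at 0 within {0..1})"
        "((\<lambda>t. - F q t) has_real_derivative q') (at 0 within {0..1})"
        using deriv[of q] deriv[of q'] q eq by simp_all
      then show "q = q'"
        using vector_derivative_unique_within_closed_interval[of 0 1 0 "\<lambda>t. - F q t" q q']
        by (simp add: has_real_derivative_iff_has_vector_derivative)
    qed
    moreover have "F ` {q. decaying_data \<gamma> q 1} \<subseteq> bvp_solutions m \<gamma>" using F by blast
    ultimately show "infinite (bvp_solutions m \<gamma>)"
      using inf by (meson finite_imageD finite_subset)
  next
    fix \<gamma> assume "\<gamma> = c"
    then show "\<exists>!f. f \<in> bvp_solutions m \<gamma>" using pick[OF c(2)] unique by blast
  next
    fix \<gamma> assume less: "\<gamma> < c"
    have "f \<notin> bvp_solutions m \<gamma>" for f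
    proof
      assume "f \<in> bvp_solutions m \<gamma>"
      then obtain y z where "decaying (\<lambda>t. - f t) y z" "f 0 = - \<gamma>" "z 0 = 1"
        unfolding bvp_solutions_def bvp by blast
      then have "c \<le> \<gamma>" using c(3) data by blast
      then show False using less by simp
    qed
    then show "bvp_solutions m \<gamma> = {}" by blast
  qed
qed

end
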